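(* Consider the agent layer $$\dot x(t)=\bar A x(t)+\bar B_u u(t)+\bar B_f f(y(t),t)+\bar B_d d(t),\qquad y(t)=\bar C_y(\mathcal A_a\otimes I_{n_x})x(t),$$ interconnected with the switched control layer $$u(t)=(\mathcal H_{c\sigma(t)}\otimes I_{n_u})\bar K x(t),$$ where all data satisfy the standing assumptions listed in the context. Suppose that the control sublayer graphs $\mathcal G_{c1},\dots,\mathcal G_{cM}$ and the gains $K_1,\dots,K_N$ are developed according to the design framework described in the context; that is, the structures of the graphs are produced by the security-constrained generation procedure, the graphs and gains are obtained by Steps 1 and 2 of the design procedure, and the validation condition of Step 3, $$\bar Q_{v\sigma}:=\bar Q+\bar K^T(\bar R+2\bar R\bar E_{c\sigma})\bar K-\frac1{a_f}\bar P\bar B_f\bar B_f^T\bar P\succ \mathbf 0\qquad\text{for all }\sigma\in\{1,\dots,M\},$$ holds. Then the closed-loop two-layer system is robustly input-to-state stable under arbitrarily fast switching. That is, for every agent layer (with all its modeling uncertainties) satisfying the standing assumptions, there exist a $\mathscr{KL}$-function $\beta$ and a $\mathscr K_\infty$-function $\kappa$ such that, for every admissible switching signal $\sigma:\mathbb R_{\ge0}\to\{1,\dots,M\}$ (with no lower bound imposed on its dwell time other than positivity), every initial state $x(0)$ and every perturbation $d\in L_\infty(\mathbb R_{\ge0})$, the solution satisfies $$\|x(t)\|\le\beta(\|x(0)\|,t)+\kappa(\|d\|_\infty)\qquad\text{for all }t\ge0 .$$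
   Context: **Notation.** $\|\cdot\|$ is the Euclidean norm of a vector or the induced 2-norm of a matrix. $\|d\|_\infty=\operatorname{ess\,sup}_{t\ge0}\|d(t)\|$. $\otimes$ is the Kronecker product. $\mathrm{diag}\{\cdot\}$ is a block-diagonal matrix and $\mathrm{col}\{\cdot\}$ a stacked column vector, over $i=1,\dots,N$. For a square real matrix $M_0$, not necessarily symmetric, $M_0\succ\mathbf 0$ means $z^TM_0z>0$ for all $z\ne0$; $\succcurlyeq$ is the corresponding semidefinite notion. The weighting matrices $Q_i,R_i$ below are symmetric. $\mathscr K_\infty$ and $\mathscr{KL}$ are the standard classes of comparison functions. **Agent layer.** There are $N\ge1$ agents. Agent $i$ has state $x_i\in\mathbb R^{n_x}$, input $u_i\in\mathbb R^{n_u}$, perturbation $d_i\in\mathbb R^{n_d}$ and interconnection variable $y_i\in\mathbb R^{n_y}$, with $$\dot x_i=A_ix_i+B_{u_i}u_i+B_{f_i}f_i(y_i,t)+B_{d_i}d_i,\qquad y_i=C_{y_i}\sum_{j}a^a_{ij}x_j .$$ - $A_i\in\mathbb R^{n_x\times n_x}$, $B_{u_i}\in\mathbb R^{n_x\times n_u}$, $B_{f_i}\in\mathbb R^{n_x\times n_g}$, $B_{d_i}\in\mathbb R^{n_x\times n_d}$, and each pair $(A_i,B_{u_i})$ is stabilizable. $B_{f_i}$ and $B_{d_i}$ need not lie in the range of $B_{u_i}$. - $\mathcal A_a=[a^a_{ij}]\in\mathbb R^{N\times N}$ is an arbitrary real matrix (entries of any sign, nonzero diagonal entries allowed). Only the value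 $\|\mathcal A_a\|$ is used in the design. - The matrices $C_{y_i}\in\mathbb R^{n_y\times n_x}$ are unknown and satisfy $\|C_{y_i}\|^2\le\gamma_{cyi}$. Put $\gamma_{cy}=\max_i\gamma_{cyi}>0$, a known constant. - The functions $f_i:\mathbb R^{n_y}\times\mathbb R_{\ge0}\to\mathbb R^{n_g}$ are unknown, piecewise continuous in $t$ and Lipschitz in $y_i$ (uniformly in $t$), so that solutions exist and are unique, and satisfy $f_i(y_i,t)^Tf_i(y_i,t)\le\gamma_{f_i}y_i^Ty_i$ for all $(y_i,t)$. Put $\gamma_f=\max_i\gamma_{f_i}>0$, a known constant. Aggregated quantities: $x=\mathrm{col}\{x_i\}$, $u=\mathrm{col}\{u_i\}$, $d=\mathrm{col}\{d_i\}$, $y=\mathrm{col}\{y_i\}$, $f=\mathrm{col}\{f_i\}$, $\bar A=\mathrm{diag}\{A_i\}$, $\bar B_u=\mathrm{diag}\{B_{u_i}\}$, $\bar B_f=\mathrm{diag}\{B_{f_i}\}$, $\bar B_d=\mathrm{diag}\{B_{d_i}\}$, $\bar C_y=\mathrm{diag}\{C_{y_i}\}$, $\bar K=\mathrm{diag}\{K_i\}$ with $K_i\in\mathbb R^{n_u\times n_x}$. **Control layer.** There are $M\ge1$ control sublayers. Sublayer $\sigma\in\{1,\dots,M\}$ is an undirected weighted graph $\mathcal G_{c\sigma}$ on the nodes $\{1,\dots,N\}$, with edge weights $a^{c\sigma}_{ij}=a^{c\sigma}_{ji}\ge0$ ($i\ne j$) and selfloop weights $s^{c\sigma}_i\ge0$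 (zero meaning no edge or no selfloop). The graph may be disconnected, but each connected component contains at least one node with $s_i^{c\sigma}>0$. Its modified Laplacian $\mathcal H_{c\sigma}=[h_{ij}^{c\sigma}]\in\mathbb R^{N\times N}$ is given by $h_{ij}^{c\sigma}=-a_{ij}^{c\sigma}$ for $j\ne i$ and $h_{ii}^{c\sigma}=\sum_{j\ne i}a_{ij}^{c\sigma}+s_i^{c\sigma}$. All eigenvalues of $\mathcal H_{c\sigma}$ are then real and positive; $\mu_{\sigma1}>0$ denotes the smallest one. **Admissible switching signals.** $\sigma:\mathbb R_{\ge0}\to\{1,\dots,M\}$ is piecewise constant, constant on each interval $[t_k,t_{k+1})$ of its switching time sequence $\{t_k\}_{k\ge 0}$, and there is some $\tau_d>0$ (depending on the signal and arbitrarily small) with $\inf_k(t_{k+1}-t_k)\ge\tau_d$. **Design framework.** *Security-constrained generation of structures.* Inputs: $M$, $N$, an integer $T$ (number of selfloops), $\theta_i\in\{0,1\}$ ($\theta_i=1$ iff node $i$ may have a selfloop), and $r_{ij}=r_{ji}\in\{0,1\}$ ($r_{ij}=0$ iff link $(i,j)$ is excluded as high-risk). For $\sigma=1,\dots,M$ successively, one finds integers $\hat\alpha^{c\sigma}_{ij}\in\{0,1\}$, $(i,j)\in\{1,\dots,N\}^2$, such that 1. $\hat\alpha_{ii}^{c\sigma}\le\theta_i$ for all $i$; 2. $\sum_i\hat\alpha_{ii}^{c\sigma}=T$; 3. $\hat\alpha_{ij}^{c\sigma}\le r_{ij}$ for all $i,j$; 4. for $i\ne j$, $\hat\alpha_{ij}^{c\sigma}=0$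 whenever link $(i,j)$ is used in a previously generated structure, i.e. $\alpha_{ij}^{c\tau}=1$ for some $\tau<\sigma$; 5. for all $i$, all $j\ne i$ and all $k\ne j$: if $\hat\alpha_{ij}^{c\sigma}=1$ and $\hat\alpha_{jk}^{c\sigma}=1$, then $\hat\alpha_{kk}^{c\sigma}=1$ and $\hat\alpha_{jj}^{c\sigma}=0$; 6. $\sum_j\hat\alpha_{ij}^{c\sigma}=1$ for all $i$. One then symmetrizes: $\alpha_{ij}^{c\sigma}=1$ if $\hat\alpha_{ij}^{c\sigma}=1$ or $\hat\alpha_{ji}^{c\sigma}=1$, and $\alpha_{ij}^{c\sigma}=0$ otherwise. The graph $\mathcal G_{c\sigma}$ has this structure: for $i\ne j$, $a_{ij}^{c\sigma}>0$ iff $\alpha_{ij}^{c\sigma}=1$; and $s_i^{c\sigma}>0$ iff $\alpha_{ii}^{c\sigma}=1$. *Design procedure.* Step 1. Choose the positive weights of the graphs $\mathcal G_{c\sigma}$, $\sigma=1,\dots,M$ (each connected component having a node with a selfloop), and set $\mu_{min}:=\min_\sigma\mu_{\sigma1}>0$. Step 2. For each agent $i$ choose symmetric positive definite $Q_i\in\mathbb R^{n_x\times n_x}$ and $R_i\in\mathbb R^{n_u\times n_u}$. With positive design scalars $a_f,a_d$, put $Q_{fi}=Q_i+(a_f\gamma_f\gamma_{cy}\|\mathcal A_a\|^2+a_d)I_{n_x}$. Let $v_i'=K_ix_i'$ be the optimal solution, over static linear stabilizing state feedbacks, of the LQR problem of minimizing $\int_0^\infty(x_i'^TQ_{fi}x_i'+v_i'^TR_iv_i')\,d\tau$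 subject to $\dot x_i'=A_ix_i'+\mu_{min}B_{u_i}v_i'$. Equivalently, $K_i=-\mu_{min}R_i^{-1}B_{u_i}^TP_i$, where $P_i$ is the unique positive definite solution of $$A_i^TP_i+P_iA_i+Q_{fi}-\mu_{min}^2P_iB_{u_i}R_i^{-1}B_{u_i}^TP_i=\mathbf 0 .$$ Step 3. With $\bar Q=\mathrm{diag}\{Q_i\}$, $\bar R=\mathrm{diag}\{R_i\}$, $\bar P=\mathrm{diag}\{P_i\}$ and $\bar E_{c\sigma}=\big(\tfrac1{\mu_{min}}\mathcal H_{c\sigma}-I_N\big)\otimes I_{n_u}$, the sublayers are valid if $\bar Q_{v\sigma}\succ\mathbf 0$ (as defined in the claim) for every $\sigma\in\{1,\dots,M\}$. *)

theory Defs
  imports "HOL-Analysis.Analysis" "HOL-Probability.Essential_Supremum"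
begin

section \<open>Aggregated vectors and matrices\<close>

text \<open>
  Agents are the elements of a finite type \<open>'n\<close>. A stacked vector with one block of type
  \<open>real ^ 'k\<close> per agent is a vector indexed by \<open>'n \<times> 'k\<close>, so that the aggregated state space is
  again a Euclidean space with the Euclidean norm.
\<close>

definition col :: "('n::finite \<Rightarrow> real ^ 'k::finite) \<Rightarrow> real ^ ('n \<times> 'k)" where
  "col v = (\<chi> p. v (fst p) $ snd p)"

definition block :: "real ^ ('n::finite \<times> 'k::finite) \<Rightarrow> 'n \<Rightarrow> real ^ 'k" where
  "block x i = (\<chi> k. x $ (i, k))"

definition bdiag :: "('n::finite \<Rightarrow> real ^ 'c::finite ^ 'r::finite) \<Rightarrow> real ^ ('n \<times> 'c) ^ ('n \<times> 'r)" where
  "bdiag M = (\<chi> p q. if fst p = fst q then M (fst p) $ snd p $ snd q else 0)"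

definition kron ::
    "real ^ 'c::finite ^ 'r::finite \<Rightarrow> real ^ 'e::finite ^ 'q::finite \<Rightarrow> real ^ ('c \<times> 'e) ^ ('r \<times> 'q)"
    (infixr "\<otimes>\<^sub>K" 72) where
  "A \<otimes>\<^sub>K B = (\<chi> p q. A $ fst p $ fst q * B $ snd p $ snd q)"

definition mat_norm :: "real ^ 'c::finite ^ 'r::finite \<Rightarrow> real" where
  "mat_norm A = onorm ((*v) A)"

definition sym_mat :: "real ^ 'n::finite ^ 'n \<Rightarrow> bool" where
  "sym_mat A \<longleftrightarrow> transpose A = A"

text \<open>Positive definiteness does not include symmetry.\<close>

definition pos_def :: "real ^ 'n::finite ^ 'n \<Rightarrow> bool" where
  "pos_def A \<longleftrightarrow> (\<forall>z. z \<noteq> 0 \<longrightarrow> 0 < z \<bullet> (A *v z))"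

definition eigval :: "'a::field ^ 'n::finite ^ 'n \<Rightarrow> 'a \<Rightarrow> bool" where
  "eigval A c \<longleftrightarrow> (\<exists>v. v \<noteq> 0 \<and> A *v v = c *s v)"

text \<open>
  Only meant for symmetric matrices, all of whose complex eigenvalues are real.
\<close>

definition smallest_eigval :: "real ^ 'n::finite ^ 'n \<Rightarrow> real" where
  "smallest_eigval A = (LEAST c. eigval A c)"

definition hurwitz :: "real ^ 'n::finite ^ 'n \<Rightarrow> bool" where
  "hurwitz A \<longleftrightarrow> (\<forall>c. eigval (map_matrix complex_of_real A) c \<longrightarrow> Re c < 0)"

definition stabilizable :: "real ^ 'n::finite ^ 'n \<Rightarrow> real ^ 'u::finite ^ 'n \<Rightarrow> bool" where
  "stabilizable A B \<longleftrightarrow> (\<exists>K :: real ^ 'n ^ 'u. hurwitz (A + B ** K))"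


section \<open>Functions of time\<close>

text \<open>
  Piecewise continuity on \<open>{0..}\<close>: finitely many discontinuities in every bounded interval, all
  of them finite jumps.
\<close>

definition piecewise_cont :: "(real \<Rightarrow> 'a::topological_space) \<Rightarrow> bool" where
  "piecewise_cont g \<longleftrightarrow>
     (\<forall>b. finite {t \<in> {0..b}. \<not> continuous (at t within {0..}) g}) \<and>
     (\<forall>t\<ge>0. \<exists>l. (g \<longlongrightarrow> l) (at_right t)) \<and>
     (\<forall>t>0. \<exists>l. (g \<longlongrightarrow> l) (at_left t))"

definition ess_sup_norm :: "(real \<Rightarrow> 'a::euclidean_space) \<Rightarrow> ereal" where
  "ess_sup_norm d = esssup (lebesgue_on {0..}) (\<lambda>t. ereal (norm (d t)))"

definition L_inf :: "(real \<Rightarrow> 'a::euclidean_space) set" where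
  "L_inf = {d \<in> borel_measurable (lebesgue_on {0..}). ess_sup_norm d < \<infinity>}"

definition L_inf_norm :: "(real \<Rightarrow> 'a::euclidean_space) \<Rightarrow> real" where
  "L_inf_norm d = real_of_ereal (ess_sup_norm d)"

definition class_K :: "(real \<Rightarrow> real) \<Rightarrow> bool" where
  "class_K \<kappa> \<longleftrightarrow> continuous_on {0..} \<kappa> \<and> strict_mono_on {0..} \<kappa> \<and> \<kappa> 0 = 0"

definition class_K_inf :: "(real \<Rightarrow> real) \<Rightarrow> bool" where
  "class_K_inf \<kappa> \<longleftrightarrow> class_K \<kappa> \<and> filterlim \<kappa> at_top at_top"

definition class_KL :: "(real \<Rightarrow> real \<Rightarrow> real) \<Rightarrow> bool" where
  "class_KL \<beta> \<longleftrightarrow>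
     continuous_on ({0..} \<times> {0..}) (\<lambda>(r, t). \<beta> r t) \<and>
     (\<forall>t\<ge>0. class_K (\<lambda>r. \<beta> r t)) \<and>
     (\<forall>r\<ge>0. antimono_on {0..} (\<beta> r) \<and> (\<beta> r \<longlongrightarrow> 0) at_top)"

text \<open>
  The switching times need not be genuine jumps, so signals with finitely many switches are
  included. The lower bound \<open>\<tau>\<close> on the dwell time depends on the signal.
\<close>

definition admissible_switching :: "nat \<Rightarrow> (real \<Rightarrow> nat) \<Rightarrow> bool" where
  "admissible_switching M \<sigma> \<longleftrightarrow>
     (\<forall>t\<ge>0. \<sigma> t \<in> {1..M}) \<and>
     (\<exists>ts :: nat \<Rightarrow> real. \<exists>\<tau>>0. ts 0 = 0 \<and>
        (\<forall>k. ts (Suc k) - ts k \<ge> \<tau>) \<and>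
        (\<forall>k. \<forall>t\<in>{ts k..<ts (Suc k)}. \<sigma> t = \<sigma> (ts k)))"


section \<open>Control sublayers\<close>

text \<open>
  A sublayer is given by edge weights \<open>a i j\<close>, of which only those with \<open>i \<noteq> j\<close> are
  meaningful, and selfloop weights \<open>s i\<close>.
\<close>

definition control_sublayer :: "('n::finite \<Rightarrow> 'n \<Rightarrow> real) \<Rightarrow> ('n \<Rightarrow> real) \<Rightarrow> bool" where
  "control_sublayer a s \<longleftrightarrow>
     (\<forall>i j. i \<noteq> j \<longrightarrow> a i j = a j i \<and> a i j \<ge> 0) \<and>
     (\<forall>i. s i \<ge> 0) \<and>
     (\<forall>i. \<exists>j. (\<lambda>p q. p \<noteq> q \<and> a p q > 0)\<^sup>*\<^sup>* i j \<and> s j > 0)"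

definition mod_laplacian :: "('n::finite \<Rightarrow> 'n \<Rightarrow> real) \<Rightarrow> ('n \<Rightarrow> real) \<Rightarrow> real ^ 'n ^ 'n" where
  "mod_laplacian a s =
     (\<chi> i j. if j = i then (\<Sum>k\<in>UNIV - {i}. a i k) + s i else - a i j)"

definition symmetrize :: "('n \<Rightarrow> 'n \<Rightarrow> int) \<Rightarrow> 'n \<Rightarrow> 'n \<Rightarrow> int" where
  "symmetrize h i j = (if h i j = 1 \<or> h j i = 1 then 1 else 0)"

text \<open>
  \<open>h \<sigma>\<close> is the solution found for sublayer \<open>\<sigma>\<close>, before symmetrization.
\<close>

definition generated_structures ::
    "nat \<Rightarrow> int \<Rightarrow> ('n::finite \<Rightarrow> int) \<Rightarrow> ('n \<Rightarrow> 'n \<Rightarrow> int) \<Rightarrow> (nat \<Rightarrow> 'n \<Rightarrow> 'n \<Rightarrow> int) \<Rightarrow> bool" where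
  "generated_structures M T \<theta> r h \<longleftrightarrow>
     (\<forall>i. \<theta> i \<in> {0, 1}) \<and>
     (\<forall>i j. r i j \<in> {0, 1} \<and> r i j = r j i) \<and>
     (\<forall>\<sigma>\<in>{1..M}.
        (\<forall>i j. h \<sigma> i j \<in> {0, 1}) \<and>
        (\<forall>i. h \<sigma> i i \<le> \<theta> i) \<and>
        (\<Sum>i\<in>UNIV. h \<sigma> i i) = T \<and>
        (\<forall>i j. h \<sigma> i j \<le> r i j) \<and>
        (\<forall>i j. i \<noteq> j \<longrightarrow> (\<exists>\<tau>\<in>{1..<\<sigma>}. symmetrize (h \<tau>) i j = 1) \<longrightarrow> h \<sigma> i j = 0) \<and>
        (\<forall>i j k. j \<noteq> i \<longrightarrow> k \<noteq> j \<longrightarrow> h \<sigma> i j = 1 \<longrightarrow> h \<sigma> j k = 1 \<longrightarrow>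
           h \<sigma> k k = 1 \<and> h \<sigma> j j = 0) \<and>
        (\<forall>i. (\<Sum>j\<in>UNIV. h \<sigma> i j) = 1))"

definition has_structure ::
    "('n \<Rightarrow> 'n \<Rightarrow> real) \<Rightarrow> ('n \<Rightarrow> real) \<Rightarrow> ('n \<Rightarrow> 'n \<Rightarrow> int) \<Rightarrow> bool" where
  "has_structure a s \<alpha> \<longleftrightarrow>
     (\<forall>i j. i \<noteq> j \<longrightarrow> (a i j > 0 \<longleftrightarrow> \<alpha> i j = 1)) \<and> (\<forall>i. s i > 0 \<longleftrightarrow> \<alpha> i i = 1)"


section \<open>Gain design\<close>

definition riccati_solution ::
    "real \<Rightarrow> real ^ 'x::finite ^ 'x \<Rightarrow> real ^ 'u::finite ^ 'x \<Rightarrow> real ^ 'x ^ 'x \<Rightarrow> real ^ 'u ^ 'u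
      \<Rightarrow> real ^ 'x ^ 'x \<Rightarrow> bool" where
  "riccati_solution \<mu> A B Q R P \<longleftrightarrow>
     sym_mat P \<and> pos_def P \<and>
     transpose A ** P + P ** A + Q
       - \<mu>\<^sup>2 *\<^sub>R (P ** B ** matrix_inv R ** transpose B ** P) = 0"

text \<open>
  The gain of the optimal state feedback for the LQR problem with state weight \<open>Q\<close>, input weight
  \<open>R\<close> and dynamics \<open>x' = A x + \<mu> B v\<close>, where \<open>P\<close> is the positive definite solution of the
  Riccati equation above.
\<close>

definition lqr_gain ::
    "real \<Rightarrow> real ^ 'u::finite ^ 'x::finite \<Rightarrow> real ^ 'u ^ 'u \<Rightarrow> real ^ 'x ^ 'x \<Rightarrow> real ^ 'x ^ 'u" where
  "lqr_gain \<mu> B R P = - (\<mu> *\<^sub>R (matrix_inv R ** transpose B ** P))"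

definition Q_v ::
    "real \<Rightarrow> real \<Rightarrow> ('n::finite \<Rightarrow> real ^ 'g::finite ^ 'x::finite) \<Rightarrow> ('n \<Rightarrow> real ^ 'x ^ 'x)
      \<Rightarrow> ('n \<Rightarrow> real ^ 'u::finite ^ 'u) \<Rightarrow> ('n \<Rightarrow> real ^ 'x ^ 'x) \<Rightarrow> ('n \<Rightarrow> real ^ 'x ^ 'u)
      \<Rightarrow> real ^ 'n ^ 'n \<Rightarrow> real ^ ('n \<times> 'x) ^ ('n \<times> 'x)" where
  "Q_v \<mu> a\<^sub>f Bf Q R P K H =
     (let E = ((1 / \<mu>) *\<^sub>R H - mat 1) \<otimes>\<^sub>K (mat 1 :: real ^ 'u ^ 'u) in
      bdiag Q
      + transpose (bdiag K) ** (bdiag R + 2 *\<^sub>R (bdiag R ** E)) ** bdiag K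
      - (1 / a\<^sub>f) *\<^sub>R (bdiag P ** bdiag Bf ** transpose (bdiag Bf) ** bdiag P))"


section \<open>Closed loop\<close>

definition agent_output ::
    "real ^ 'n::finite ^ 'n \<Rightarrow> ('n \<Rightarrow> real ^ 'x::finite ^ 'y::finite) \<Rightarrow> real ^ ('n \<times> 'x)
      \<Rightarrow> real ^ ('n \<times> 'y)" where
  "agent_output Aa Cy x = bdiag Cy *v ((Aa \<otimes>\<^sub>K (mat 1 :: real ^ 'x ^ 'x)) *v x)"

lemma block_bdiag_mult: "block (bdiag M *v x) i = M i *v block x i"
proof -
  have "(\<Sum>q\<in>UNIV. (if i = fst q then M i $ l $ snd q else 0) * x $ q)
      = (\<Sum>k\<in>UNIV. M i $ l $ k * x $ (i, k))" for l
    by (simp add: UNIV_Times_UNIV[symmetric] sum.cartesian_product' if_distrib[of "\<lambda>c. c * _"]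
        del: UNIV_Times_UNIV cong: if_cong) (subst sum.swap, simp)
  then show ?thesis
    by (simp add: vec_eq_iff block_def bdiag_def matrix_vector_mult_def cong: if_cong)
qed

lemma block_kron_mat_1_mult:
  "block ((A \<otimes>\<^sub>K mat 1) *v x) i = (\<Sum>j\<in>UNIV. A $ i $ j *\<^sub>R block x j)"
  by (simp add: vec_eq_iff block_def kron_def matrix_vector_mult_def mat_def
      UNIV_Times_UNIV[symmetric] sum.cartesian_product' if_distrib[of "\<lambda>c. _ * c"]
      if_distrib[of "\<lambda>c. c * _"] del: UNIV_Times_UNIV cong: if_cong)

lemma block_agent_output:
  "block (agent_output Aa Cy x) i = Cy i *v (\<Sum>j\<in>UNIV. Aa $ i $ j *\<^sub>R block x j)"
  by (simp add: agent_output_def block_bdiag_mult block_kron_mat_1_mult)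

definition closed_loop_rhs ::
    "('n::finite \<Rightarrow> real ^ 'x::finite ^ 'x) \<Rightarrow> ('n \<Rightarrow> real ^ 'u::finite ^ 'x)
      \<Rightarrow> ('n \<Rightarrow> real ^ 'g::finite ^ 'x) \<Rightarrow> ('n \<Rightarrow> real ^ 'd::finite ^ 'x)
      \<Rightarrow> real ^ 'n ^ 'n \<Rightarrow> ('n \<Rightarrow> real ^ 'x ^ 'y::finite)
      \<Rightarrow> ('n \<Rightarrow> real ^ 'y \<Rightarrow> real \<Rightarrow> real ^ 'g) \<Rightarrow> ('n \<Rightarrow> real ^ 'x ^ 'u)
      \<Rightarrow> real ^ 'n ^ 'n \<Rightarrow> real ^ ('n \<times> 'd) \<Rightarrow> real \<Rightarrow> real ^ ('n \<times> 'x)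
      \<Rightarrow> real ^ ('n \<times> 'x)" where
  "closed_loop_rhs A Bu Bf Bd Aa Cy f K H d t x =
     bdiag A *v x
     + bdiag Bu *v ((H \<otimes>\<^sub>K (mat 1 :: real ^ 'u ^ 'u)) *v (bdiag K *v x))
     + bdiag Bf *v col (\<lambda>i. f i (block (agent_output Aa Cy x) i) t)
     + bdiag Bd *v d"

text \<open>
  Since perturbations are merely measurable, solutions are understood in the sense of
  Caratheodory, that is as solutions of the integral equation.
\<close>

definition caratheodory_solution ::
    "(real \<Rightarrow> 'a::euclidean_space \<Rightarrow> 'a) \<Rightarrow> (real \<Rightarrow> 'a) \<Rightarrow> bool" where
  "caratheodory_solution F x \<longleftrightarrow>
     (\<forall>t\<ge>0. (\<lambda>\<tau>. F \<tau> (x \<tau>)) absolutely_integrable_on {0..t} \<and>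
            ((\<lambda>\<tau>. F \<tau> (x \<tau>)) has_integral (x t - x 0)) {0..t})"

end

theory Submission
  imports Defs
begin

text \<open>
  \<open>V x = x\<^sup>T P x\<close>, with \<open>P\<close> block diagonal, is a common quadratic Lyapunov function for all sublayers.
  Since \<open>R\<^sub>i K\<^sub>i = - \<mu> B\<^sub>i\<^sup>T P\<^sub>i\<close>, the Riccati equations cancel the linear and the input terms of the
  derivative up to \<open>- x\<^sup>T Q\<^sub>v\<^sub>\<sigma> x - a\<^sub>d |x|\<^sup>2\<close>, once Young's inequality with weight \<open>a\<^sub>f\<close> has traded the
  interconnection \<open>2 x\<^sup>T P B\<^sub>f f\<close> for \<open>x\<^sup>T P B\<^sub>f B\<^sub>f\<^sup>T P x / a\<^sub>f\<close> (part of \<open>Q\<^sub>v\<^sub>\<sigma>\<close>) and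
  \<open>a\<^sub>f |f|\<^sup>2 \<le> a\<^sub>f \<gamma>\<^sub>f \<gamma>\<^sub>c\<^sub>y |A\<^sub>a|\<^sup>2 |x|\<^sup>2\<close> (part of the state weight). The decay rate of \<open>V\<close> does not depend
  on \<open>\<sigma>\<close>, so switching is harmless. As solutions are only indefinite integrals, the decay is derived from the
  integrated inequality for \<open>V\<close> instead of from derivatives.
\<close>

section \<open>Quadratic forms along indefinite integrals\<close>

text \<open>Cut \<open>{a..b}\<close> into \<open>n\<close> equal pieces shorter than
  \<open>\<delta>\<close>: the increments of \<open>G\<close> add up by the triangle inequality and
  those of \<open>m\<close> telescope. This turns estimates based on uniform continuity into a bound
  on the whole interval.\<close>

lemma local_to_global_increment_bound:
  fixes G :: "real \<Rightarrow> 'a::real_normed_vector" and m :: "real \<Rightarrow> real"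
  assumes "\<delta> > 0" and "a \<le> b"
    and loc: "\<And>u v. a \<le> u \<Longrightarrow> u \<le> v \<Longrightarrow> v \<le> b \<Longrightarrow> v - u < \<delta> \<Longrightarrow> norm (G v - G u) \<le> m v - m u"
  shows "norm (G b - G a) \<le> m b - m a"
proof -
  obtain n :: nat where n: "(b - a) / \<delta> < real n"
    using reals_Archimedean2 by blast
  moreover have "(b - a) / \<delta> \<ge> 0"
    using \<open>a \<le> b\<close> \<open>\<delta> > 0\<close> by simp
  ultimately have "n > 0"
    by (cases n) auto
  define t where "t k = a + real k * ((b - a) / real n)" for k
  have t_n: "t n = b"
    using \<open>n > 0\<close> by (simp add: t_def)
  have t_mono: "t j \<le> t k" if "j \<le> k" for j k
    using that \<open>a \<le> b\<close> by (simp add: t_def mult_right_mono divide_right_mono)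
  have mesh: "t (Suc k) - t k < \<delta>" for k
  proof -
    have "t (Suc k) - t k = (b - a) / real n"
      by (simp add: t_def distrib_right add_divide_distrib)
    also have "\<dots> < \<delta>"
      using n \<open>n > 0\<close> \<open>\<delta> > 0\<close> by (simp add: divide_less_eq mult.commute)
    finally show ?thesis .
  qed
  have "norm (G (t k) - G a) \<le> m (t k) - m a" if "k \<le> n" for k
    using that
  proof (induction k)
    case 0
    then show ?case by (simp add: t_def)
  next
    case (Suc k)
    have "norm (G (t (Suc k)) - G (t k)) \<le> m (t (Suc k)) - m (t k)"
      using t_mono[of 0 k] t_mono[of k "Suc k"] t_mono[of "Suc k" n] Suc.prems t_n mesh
      by (intro loc) (simp_all add: t_def)
    moreover have "norm (G (t k) - G a) \<le> m (t k) - m a"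
      using Suc by simp
    ultimately show ?case
      using norm_triangle_ineq[of "G (t (Suc k)) - G (t k)" "G (t k) - G a"] by simp
  qed
  from this[of n] show ?thesis
    by (simp add: t_n)
qed

text \<open>
  On a short interval \<open>{u..v}\<close> the increment of \<open>x \<bullet> P x\<close> is \<open>P (x u + x v) \<bullet> \<integral>f\<close>, which differs from
  \<open>\<integral>2 (P x \<bullet> f)\<close> by at most \<open>e \<integral>|f|\<close> because \<open>x\<close> is uniformly continuous.
\<close>

lemma quadratic_form_indefinite_integral:
  fixes P :: "'a::euclidean_space \<Rightarrow> 'a" and x f :: "real \<Rightarrow> 'a"
  assumes "a \<le> b"
    and lin: "bounded_linear P" and self_adj: "\<And>u v. P u \<bullet> v = u \<bullet> P v"
    and f: "f absolutely_integrable_on {a..b}"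
    and x: "\<And>u. u \<in> {a..b} \<Longrightarrow> (f has_integral (x u - x a)) {a..u}"
  shows "(\<lambda>\<tau>. 2 * (P (x \<tau>) \<bullet> f \<tau>)) absolutely_integrable_on {a..b}"
    and "integral {a..b} (\<lambda>\<tau>. 2 * (P (x \<tau>) \<bullet> f \<tau>)) = x b \<bullet> P (x b) - x a \<bullet> P (x a)"
proof -
  interpret P: bounded_linear P by (fact lin)
  have f_int: "f integrable_on {a..b}" and nf_int: "(\<lambda>\<tau>. norm (f \<tau>)) integrable_on {a..b}"
    using f absolutely_integrable_on_def by blast+
  have "continuous_on {a..b} (\<lambda>u. x a + integral {a..u} f)"
    by (intro continuous_intros indefinite_integral_continuous_1 f_int)
  moreover have "x a + integral {a..u} f = x u" if "u \<in> {a..b}" for u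
    using integral_unique[OF x[OF that]] by simp
  ultimately have cont: "continuous_on {a..b} x"
    by (rule continuous_on_eq)
  then have cont_P: "continuous_on {a..b} (\<lambda>\<tau>. P (x \<tau>))"
    by (intro P.continuous_on)
  \<comment> \<open>A continuous factor is measurable and bounded on the compact interval, so the
    product with \<open>f\<close> stays absolutely integrable.\<close>
  have inner_abs: "(\<lambda>\<tau>. g \<tau> \<bullet> f \<tau>) absolutely_integrable_on {a..b}"
    if "continuous_on {a..b} g" for g
  proof (rule absolutely_integrable_bounded_measurable_product[where h = "(\<bullet>)"])
    show "bilinear ((\<bullet>) :: 'a \<Rightarrow> _)"
      by (simp add: bilinear_conv_bounded_bilinear bounded_bilinear_inner)
    show "g \<in> borel_measurable (lebesgue_on {a..b})"
      by (intro continuous_imp_measurable_on_sets_lebesgue that) auto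
    show "bounded (g ` {a..b})"
      by (intro compact_imp_bounded compact_continuous_image that) auto
  qed (use f in auto)
  have abs: "(\<lambda>\<tau>. 2 * (P (x \<tau>) \<bullet> f \<tau>)) absolutely_integrable_on {a..b}"
    using inner_abs[of "\<lambda>\<tau>. 2 *\<^sub>R P (x \<tau>)"] cont_P by (simp add: continuous_intros)
  then show "(\<lambda>\<tau>. 2 * (P (x \<tau>) \<bullet> f \<tau>)) absolutely_integrable_on {a..b}" .
  define g where "g = (\<lambda>\<tau>. 2 * (P (x \<tau>) \<bullet> f \<tau>))"
  have g_int: "g integrable_on {a..b}"
    unfolding g_def using abs absolutely_integrable_on_def by blast
  obtain B where "B > 0" and B: "\<And>v. norm (P v) \<le> norm v * B"
    using P.pos_bounded by blast
  \<comment> \<open>\<open>G\<close> is the defect of the claimed identity. Its increment is shown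
    to be below every positive number.\<close>
  define G where "G u = x u \<bullet> P (x u) - integral {a..u} g" for u
  have bound: "\<bar>G b - G a\<bar> \<le> e * integral {a..b} (\<lambda>\<tau>. norm (f \<tau>))" if "e > 0" for e
  proof -
    have "uniformly_continuous_on {a..b} x"
      using cont by (intro compact_uniformly_continuous) auto
    \<comment> \<open>The bound \<open>e / (2 * B)\<close> is used at both endpoints, and
      \<open>P\<close> magnifies the sum of the two differences by at most \<open>B\<close>, which
      leaves \<open>e\<close>.\<close>
    then obtain \<delta> where "\<delta> > 0" and \<delta>: "\<And>u v. u \<in> {a..b} \<Longrightarrow> v \<in> {a..b} \<Longrightarrow> dist v u < \<delta>
        \<Longrightarrow> dist (x v) (x u) < e / (2 * B)"
      unfolding uniformly_continuous_on_def using \<open>B > 0\<close> \<open>e > 0\<close>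
      by (metis divide_pos_pos mult_pos_pos zero_less_numeral)
    have "norm (G b - G a) \<le> e * integral {a..b} (\<lambda>\<tau>. norm (f \<tau>)) - e * integral {a..a} (\<lambda>\<tau>. norm (f \<tau>))"
    proof (rule local_to_global_increment_bound[OF \<open>\<delta> > 0\<close> \<open>a \<le> b\<close>])
      fix u v assume uv: "a \<le> u" "u \<le> v" "v \<le> b" "v - u < \<delta>"
      have sub: "{a..v} \<subseteq> {a..b}" "{u..v} \<subseteq> {a..b}"
        using uv by auto
      have on: "h integrable_on {a..v}" "h integrable_on {u..v}" if "h integrable_on {a..b}"
        for h :: "real \<Rightarrow> 'b::euclidean_space"
        using integrable_subinterval_real[OF that] sub by auto
      have comb: "integral {a..v} h - integral {a..u} h = integral {u..v} h"
        if "h integrable_on {a..b}" for h :: "real \<Rightarrow> 'b::euclidean_space"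
        using Henstock_Kurzweil_Integration.integral_combine[OF uv(1,2) on(1)[OF that]] by (simp add: algebra_simps)
      have x_incr: "integral {u..v} f = x v - x u"
        using comb[OF f_int] integral_unique[OF x, of u] integral_unique[OF x, of v] uv by simp
      define p where "p = P (x v + x u)"
      have p_int: "(\<lambda>\<tau>. p \<bullet> f \<tau>) integrable_on {u..v}"
        using integrable_linear[OF on(2)[OF f_int] bounded_linear_inner_right[of p]]
        by (simp add: o_def)
      \<comment> \<open>A difference of squares: the mixed terms cancel because \<open>P\<close> is
        self-adjoint.\<close>
      have "x v \<bullet> P (x v) - x u \<bullet> P (x u) = p \<bullet> (x v - x u)"
        by (simp add: p_def P.add inner_simps self_adj) (metis inner_commute self_adj)
      also have "\<dots> = integral {u..v} (\<lambda>\<tau>. p \<bullet> f \<tau>)"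
        using integral_linear[OF on(2)[OF f_int] bounded_linear_inner_right[of p]]
        by (simp add: o_def x_incr)
      finally have "G v - G u = integral {u..v} (\<lambda>\<tau>. p \<bullet> f \<tau> - g \<tau>)"
        using comb[OF g_int] by (simp add: G_def integral_diff[OF p_int on(2)[OF g_int]])
      also have "norm \<dots> \<le> integral {u..v} (\<lambda>\<tau>. e * norm (f \<tau>))"
      proof (rule integral_norm_bound_integral)
        show "(\<lambda>\<tau>. p \<bullet> f \<tau> - g \<tau>) integrable_on {u..v}"
          by (intro integrable_diff p_int on(2)[OF g_int])
        show "(\<lambda>\<tau>. e * norm (f \<tau>)) integrable_on {u..v}"
          using on(2)[OF nf_int] by (rule integrable_on_mult_right)
        fix \<tau> assume \<tau>: "\<tau> \<in> {u..v}"
        have close: "norm (x w - x \<tau>) < e / (2 * B)" if "w = u \<or> w = v" for w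
          using \<delta>[of \<tau> w] that \<tau> uv by (auto simp: dist_norm)
        \<comment> \<open>The factor 2 in \<open>g\<close> is split into two copies of
          \<open>x \<tau>\<close>, one compared with each endpoint.\<close>
        have "p \<bullet> f \<tau> - g \<tau> = P ((x v - x \<tau>) + (x u - x \<tau>)) \<bullet> f \<tau>"
          by (simp add: p_def g_def P.add P.diff inner_simps)
        also have "norm \<dots> \<le> norm (P ((x v - x \<tau>) + (x u - x \<tau>))) * norm (f \<tau>)"
          by (simp add: Cauchy_Schwarz_ineq2)
        also have "\<dots> \<le> e * norm (f \<tau>)"
        proof (rule mult_right_mono)
          have "norm (P ((x v - x \<tau>) + (x u - x \<tau>))) \<le> norm ((x v - x \<tau>) + (x u - x \<tau>)) * B"
            by (rule B)
          also have "\<dots> \<le> (e / (2 * B) + e / (2 * B)) * B"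
            using close[of u] close[of v] \<open>B > 0\<close>
              norm_triangle_ineq[of "x v - x \<tau>" "x u - x \<tau>"]
            by (intro mult_right_mono) auto
          finally show "norm (P ((x v - x \<tau>) + (x u - x \<tau>))) \<le> e"
            using \<open>B > 0\<close> by simp
        qed simp
        finally show "norm (p \<bullet> f \<tau> - g \<tau>) \<le> e * norm (f \<tau>)" .
      qed
      finally show "norm (G v - G u)
          \<le> e * integral {a..v} (\<lambda>\<tau>. norm (f \<tau>)) - e * integral {a..u} (\<lambda>\<tau>. norm (f \<tau>))"
        using comb[OF nf_int] by (simp add: right_diff_distrib[symmetric])
    qed
    then show ?thesis by simp
  qed
  define m where "m = integral {a..b} (\<lambda>\<tau>. norm (f \<tau>))"
  have "m \<ge> 0"
    unfolding m_def by (intro integral_nonneg nf_int) simp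
  have "\<bar>G b - G a\<bar> \<le> 0"
  proof (rule field_le_epsilon)
    fix e :: real assume "e > 0"
    \<comment> \<open>Dividing by \<open>m + 1\<close> instead of \<open>m\<close> covers the case
      \<open>m = 0\<close>.\<close>
    have "\<bar>G b - G a\<bar> \<le> e / (m + 1) * m"
      using bound[of "e / (m + 1)"] \<open>e > 0\<close> \<open>m \<ge> 0\<close> by (simp add: m_def)
    also have "\<dots> \<le> 0 + e"
      using \<open>e > 0\<close> \<open>m \<ge> 0\<close> by (simp add: field_simps)
    finally show "\<bar>G b - G a\<bar> \<le> 0 + e" .
  qed
  then show "integral {a..b} (\<lambda>\<tau>. 2 * (P (x \<tau>) \<bullet> f \<tau>)) = x b \<bullet> P (x b) - x a \<bullet> P (x a)"
    by (simp add: G_def g_def)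
qed

text \<open>Comparison with the solution \<open>E\<close> of the equation E' = c - \<alpha> E that
  starts at \<open>W 0\<close>. The difference \<open>Z\<close> vanishes at 0, and on any interval
  where it is positive its integrated inequality forbids growth. The increment bound must start from
  an arbitrary time \<open>s\<close>, since it is applied from the last time at which
  \<open>Z\<close> is nonpositive.\<close>

lemma linear_integral_inequality_decay:
  fixes W :: "real \<Rightarrow> real"
  assumes "\<alpha> > 0" and cont: "continuous_on {0..} W"
    and incr: "\<And>s t. 0 \<le> s \<Longrightarrow> s \<le> t \<Longrightarrow> W t - W s \<le> integral {s..t} (\<lambda>\<tau>. c - \<alpha> * W \<tau>)"
    and "t \<ge> 0"
  shows "W t \<le> exp (- \<alpha> * t) * W 0 + (1 - exp (- \<alpha> * t)) * (c / \<alpha>)"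
proof -
  define E where "E \<tau> = exp (- \<alpha> * \<tau>) * (W 0 - c / \<alpha>) + c / \<alpha>" for \<tau>
  define Z where "Z \<tau> = W \<tau> - E \<tau>" for \<tau>
  have contZ: "continuous_on S Z" if "S \<subseteq> {0..}" for S
    unfolding Z_def E_def by (intro continuous_intros continuous_on_subset[OF cont that])
  have E_incr: "((\<lambda>\<tau>. c - \<alpha> * E \<tau>) has_integral (E t - E s)) {s..t}" if "s \<le> t" for s t
  proof (rule fundamental_theorem_of_calculus[OF that])
    fix \<tau>
    have "(E has_real_derivative (c - \<alpha> * E \<tau>)) (at \<tau> within {s..t})"
      unfolding E_def using \<open>\<alpha> > 0\<close> by (auto intro!: derivative_eq_intros simp: field_simps)
    then show "(E has_vector_derivative (c - \<alpha> * E \<tau>)) (at \<tau> within {s..t})"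
      by (simp add: has_real_derivative_iff_has_vector_derivative)
  qed
  have Z_incr: "Z v - Z u \<le> integral {u..v} (\<lambda>\<tau>. - \<alpha> * Z \<tau>)" if "0 \<le> u" "u \<le> v" for u v
  proof -
    have W_int: "(\<lambda>\<tau>. c - \<alpha> * W \<tau>) integrable_on {u..v}"
      using that by (intro integrable_continuous_interval continuous_intros
          continuous_on_subset[OF cont]) auto
    have "integral {u..v} (\<lambda>\<tau>. - \<alpha> * Z \<tau>)
        = integral {u..v} (\<lambda>\<tau>. (c - \<alpha> * W \<tau>) - (c - \<alpha> * E \<tau>))"
      by (simp add: Z_def algebra_simps)
    also have "\<dots> = integral {u..v} (\<lambda>\<tau>. c - \<alpha> * W \<tau>) - (E v - E u)"
      using integral_diff[OF W_int has_integral_integrable[OF E_incr[OF that(2)]]]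
        integral_unique[OF E_incr[OF that(2)]] by simp
    finally show ?thesis
      using incr[OF that] by (simp add: Z_def)
  qed
  have "Z t \<le> 0"
  proof (rule ccontr)
    assume "\<not> Z t \<le> 0"
    \<comment> \<open>\<open>Z\<close> cannot increase after the last time at which it is nonpositive.\<close>
    define S where "S = {0..t} \<inter> Z -` {..0}"
    have "closed S"
      unfolding S_def by (intro continuous_closed_preimage contZ) auto
    moreover have "0 \<in> S"
      using \<open>t \<ge> 0\<close> by (simp add: S_def Z_def E_def)
    moreover have "bdd_above S"
      unfolding S_def by (rule bdd_above_Int1) simp
    ultimately have "Sup S \<in> S"
      by (intro closed_contains_Sup) auto
    then have s: "0 \<le> Sup S" "Sup S \<le> t" "Z (Sup S) \<le> 0"
      by (auto simp: S_def)
    have pos: "Z \<tau> > 0" if "\<tau> \<in> {Sup S<..t}" for \<tau>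
    proof (rule ccontr)
      assume "\<not> Z \<tau> > 0"
      then have "\<tau> \<in> S"
        using that s by (auto simp: S_def)
      then show False
        using that cSup_upper[OF _ \<open>bdd_above S\<close>] by fastforce
    qed
    have "integral {Sup S..t} (\<lambda>\<tau>. - \<alpha> * Z \<tau>) \<le> 0"
    proof -
      \<comment> \<open>The left endpoint is removed as a null set, because the sign of the
        integrand is known only to its right.\<close>
      have "integral {Sup S..t} (\<lambda>\<tau>. - \<alpha> * Z \<tau>) = integral {Sup S<..t} (\<lambda>\<tau>. - \<alpha> * Z \<tau>)"
        by (rule integral_subset_negligible[symmetric])
          (auto intro: negligible_subset[of "{Sup S}"])
      also have "\<dots> \<le> integral {Sup S<..t} (\<lambda>\<tau>. 0)"
      proof (rule integral_le)
        have "(\<lambda>\<tau>. - \<alpha> * Z \<tau>) integrable_on {Sup S..t}"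
          using s by (intro integrable_continuous_interval continuous_intros contZ) auto
        then show "(\<lambda>\<tau>. - \<alpha> * Z \<tau>) integrable_on {Sup S<..t}"
          by (rule integrable_spike_set) (auto intro: negligible_subset[of "{Sup S}"])
      qed (use pos \<open>\<alpha> > 0\<close> in \<open>auto simp: less_imp_le integrable_0\<close>)
      finally show ?thesis by simp
    qed
    then show False
      using Z_incr[OF s(1,2)] s(3) \<open>\<not> Z t \<le> 0\<close> by simp
  qed
  then show ?thesis
    by (simp add: Z_def E_def algebra_simps)
qed


section \<open>Input-to-state stability from a quadratic Lyapunov function\<close>

lemma AE_norm_le_L_inf_norm:
  assumes "d \<in> L_inf"
  shows "AE t in lebesgue_on {0..}. norm (d t) \<le> L_inf_norm d"
proof -
  have "ess_sup_norm d < \<infinity>"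
    using assms by (simp add: L_inf_def)
  \<comment> \<open>\<open>real_of_ereal\<close> maps infinite values to 0, so both must be
    excluded: plus infinity by membership in \<open>L_inf\<close>, minus infinity because it bounds
    no norm.\<close>
  then have "norm (d t) \<le> L_inf_norm d" if "ereal (norm (d t)) \<le> ess_sup_norm d" for t
    using that by (cases "ess_sup_norm d") (auto simp: L_inf_norm_def)
  then show ?thesis
    using esssup_AE[of "\<lambda>t. ereal (norm (d t))" "lebesgue_on {0..}"]
    by (auto simp: ess_sup_norm_def elim!: eventually_mono)
qed

text \<open>A negative essential bound would hold nowhere, hence the half-line would be a null set,
  although it contains an interval of measure 1.\<close>

lemma L_inf_norm_nonneg:
  assumes "d \<in> L_inf"
  shows "L_inf_norm d \<ge> 0"
proof (rule ccontr)
  assume "\<not> L_inf_norm d \<ge> 0"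
  then have "\<not> norm (d t) \<le> L_inf_norm d" for t
    using norm_ge_zero[of "d t"] by linarith
  then have "AE t in lebesgue_on {0::real..}. False"
    by (intro eventually_mono[OF AE_norm_le_L_inf_norm[OF assms]]) blast
  then have "emeasure (lebesgue_on {0..}) {0::real..} = 0"
    using AE_iff_measurable[of "{0..}" "lebesgue_on {0::real..}" "\<lambda>_. False"] by (simp add: atLeast_def)
  then have "emeasure lebesgue {0::real..} = 0"
    by (simp add: emeasure_restrict_space)
  moreover have "emeasure lebesgue {0..1::real} \<le> emeasure lebesgue {0::real..}"
    by (intro emeasure_mono) auto
  ultimately show False
    by simp
qed

section \<open>Caratheodory solutions on subintervals\<close>

lemma caratheodory_solution_restart:
  assumes "caratheodory_solution F x" "0 \<le> s" "s \<le> t"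
  shows "(\<lambda>\<tau>. F \<tau> (x \<tau>)) absolutely_integrable_on {s..t}"
    and "((\<lambda>\<tau>. F \<tau> (x \<tau>)) has_integral (x t - x s)) {s..t}"
proof -
  have abs: "(\<lambda>\<tau>. F \<tau> (x \<tau>)) absolutely_integrable_on {0..t}"
    and I: "\<And>t. t \<ge> 0 \<Longrightarrow> ((\<lambda>\<tau>. F \<tau> (x \<tau>)) has_integral (x t - x 0)) {0..t}"
    using assms by (auto simp: caratheodory_solution_def)
  show *: "(\<lambda>\<tau>. F \<tau> (x \<tau>)) absolutely_integrable_on {s..t}"
    using assms by (intro absolutely_integrable_on_subinterval[OF abs]) auto
  have "integral {0..s} (\<lambda>\<tau>. F \<tau> (x \<tau>)) + integral {s..t} (\<lambda>\<tau>. F \<tau> (x \<tau>))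
      = integral {0..t} (\<lambda>\<tau>. F \<tau> (x \<tau>))"
    using assms I[of t] by (intro Henstock_Kurzweil_Integration.integral_combine) auto
  moreover have "integral {0..u} (\<lambda>\<tau>. F \<tau> (x \<tau>)) = x u - x 0" if "u \<ge> 0" for u
    using I[OF that] by (rule integral_unique)
  ultimately have "integral {s..t} (\<lambda>\<tau>. F \<tau> (x \<tau>)) = x t - x s"
    using assms by (simp add: algebra_simps)
  then show "((\<lambda>\<tau>. F \<tau> (x \<tau>)) has_integral (x t - x s)) {s..t}"
    using * absolutely_integrable_on_def has_integral_iff by blast
qed

lemma caratheodory_solution_continuous:
  assumes "caratheodory_solution F x"
  shows "continuous_on {0..} x"
proof -
  have "continuous_on {0..b} x" for b
  proof (cases "b \<ge> 0")
    case True
    have "continuous_on {0..b} (\<lambda>u. x 0 + integral {0..u} (\<lambda>\<tau>. F \<tau> (x \<tau>)))"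
      using caratheodory_solution_restart(2)[OF assms _ True]
      by (intro continuous_intros indefinite_integral_continuous_1) auto
    then show ?thesis
    proof (rule continuous_on_eq)
      fix u assume "u \<in> {0..b}"
      then show "x 0 + integral {0..u} (\<lambda>\<tau>. F \<tau> (x \<tau>)) = x u"
        using integral_unique[OF caratheodory_solution_restart(2)[OF assms, of 0 u]] by simp
    qed
  qed auto
  \<comment> \<open>Extending \<open>x\<close> constantly to negative times makes every time, 0
    included, an interior point of some \<open>{..b}\<close>, so that continuity on bounded
    intervals gives continuity on the half-line.\<close>
  then have "isCont (\<lambda>u. x (max 0 u)) t" for t
  proof -
    have "continuous_on {..\<bar>t\<bar> + 1} (\<lambda>u. x (max 0 u))"
      by (rule continuous_on_compose2[OF \<open>continuous_on {0..\<bar>t\<bar> + 1} x\<close>])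
        (auto intro!: continuous_intros)
    then show ?thesis
      by (rule continuous_on_interior) simp
  qed
  then have "continuous_on {0..} (\<lambda>u. x (max 0 u))"
    by (simp add: continuous_at_imp_continuous_on)
  then show ?thesis
    by (rule continuous_on_eq) simp
qed

text \<open>By \<open>upper\<close>, the decay term \<open>\<alpha> * (norm v)\<^sup>2\<close>
  dominates \<open>\<alpha> / p\<close> times the quadratic form, so the form satisfies the
  comparison inequality with rate \<open>\<alpha> / p\<close> and constant \<open>b\<close>. The
  dissipation bound is pointwise in time, so \<open>F\<close> may jump from one sublayer to
  another.\<close>

lemma quadratic_lyapunov_estimate:
  fixes P :: "'a::euclidean_space \<Rightarrow> 'a" and d :: "real \<Rightarrow> 'b::euclidean_space"
  assumes lin: "bounded_linear P" and self_adj: "\<And>u v. P u \<bullet> v = u \<bullet> P v"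
    and upper: "\<And>v. v \<bullet> P v \<le> p * (norm v)\<^sup>2" and "p > 0" "\<alpha> > 0" "c \<ge> 0"
    and diss: "\<And>t v. t \<ge> 0 \<Longrightarrow> 2 * (P v \<bullet> F t v) \<le> c * (norm (d t))\<^sup>2 - \<alpha> * (norm v)\<^sup>2"
    and d: "d \<in> L_inf" and sol: "caratheodory_solution F x" and "t \<ge> 0"
  shows "x t \<bullet> P (x t)
    \<le> exp (- (\<alpha> / p) * t) * (x 0 \<bullet> P (x 0)) + c * p / \<alpha> * (L_inf_norm d)\<^sup>2"
proof -
  define b where "b = c * (L_inf_norm d)\<^sup>2"
  have "b \<ge> 0"
    using \<open>c \<ge> 0\<close> by (simp add: b_def)
  have "\<alpha> / p > 0"
    using \<open>\<alpha> > 0\<close> \<open>p > 0\<close> by simp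
  have "AE \<tau> in lebesgue. \<tau> \<in> {0..} \<longrightarrow> norm (d \<tau>) \<le> L_inf_norm d"
    using AE_norm_le_L_inf_norm[OF d] by (simp add: AE_restrict_space_iff)
  then obtain N where "N \<in> null_sets lebesgue"
    and N0: "{\<tau> \<in> space lebesgue. \<not> (\<tau> \<in> {0..} \<longrightarrow> norm (d \<tau>) \<le> L_inf_norm d)} \<subseteq> N"
    unfolding eventually_ae_filter by blast
  then have negl: "negligible N"
    by (simp add: negligible_iff_null_sets)
  have N: "norm (d \<tau>) \<le> L_inf_norm d" if "\<tau> \<ge> 0" "\<tau> \<notin> N" for \<tau>
    using N0 that by auto
  define W where "W \<tau> = x \<tau> \<bullet> P (x \<tau>)" for \<tau>
  have contW: "continuous_on {0..} W"
    unfolding W_def using caratheodory_solution_continuous[OF sol]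
    by (intro continuous_intros bounded_linear.continuous_on[OF lin])
  have "W t \<le> exp (- (\<alpha> / p) * t) * W 0 + (1 - exp (- (\<alpha> / p) * t)) * (b / (\<alpha> / p))"
  proof (rule linear_integral_inequality_decay[OF \<open>\<alpha> / p > 0\<close> contW _ \<open>t \<ge> 0\<close>])
    fix s t :: real assume st: "0 \<le> s" "s \<le> t"
    define g where "g = (\<lambda>\<tau>. 2 * (P (x \<tau>) \<bullet> F \<tau> (x \<tau>)))"
    define u where "u = (\<lambda>\<tau>. b - \<alpha> / p * W \<tau>)"
    have g_abs: "g absolutely_integrable_on {s..t}" and g_int: "integral {s..t} g = W t - W s"
      unfolding g_def W_def
      using quadratic_form_indefinite_integral[OF st(2) lin self_adj
          caratheodory_solution_restart(1)[OF sol st], of x] caratheodory_solution_restart(2)[OF sol] st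
      by auto
    have "u integrable_on {s..t}"
      unfolding u_def using st
      by (intro integrable_continuous_interval continuous_intros continuous_on_subset[OF contW]) auto
    \<comment> \<open>On the null set \<open>N\<close>, where \<open>d\<close> may exceed its
      essential bound, the integrand is overwritten by its intended majorant \<open>u\<close>. This
      leaves the integral unchanged and makes the comparison hold at every point.\<close>
    have "W t - W s = integral {s..t} (\<lambda>\<tau>. if \<tau> \<in> N then u \<tau> else g \<tau>)"
      using g_int integral_spike[OF negl, of "{s..t}" g "\<lambda>\<tau>. if \<tau> \<in> N then u \<tau> else g \<tau>"] by simp
    also have "\<dots> \<le> integral {s..t} u"
    proof (rule integral_le[OF _ \<open>u integrable_on {s..t}\<close>])
      show "(\<lambda>\<tau>. if \<tau> \<in> N then u \<tau> else g \<tau>) integrable_on {s..t}"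
      proof (rule integrable_spike[OF _ negl])
        show "g integrable_on {s..t}"
          using g_abs absolutely_integrable_on_def by blast
      qed simp
      fix \<tau> assume "\<tau> \<in> {s..t}"
      then have "\<tau> \<ge> 0" using st by simp
      have "g \<tau> \<le> u \<tau>" if "\<tau> \<notin> N"
      proof -
        have "(norm (d \<tau>))\<^sup>2 \<le> (L_inf_norm d)\<^sup>2"
          using N[OF \<open>\<tau> \<ge> 0\<close> that] by (simp add: power_mono)
        then have "c * (norm (d \<tau>))\<^sup>2 \<le> b"
          unfolding b_def using \<open>c \<ge> 0\<close> by (rule mult_left_mono)
        moreover have "\<alpha> / p * W \<tau> \<le> \<alpha> * (norm (x \<tau>))\<^sup>2"
          using upper[of "x \<tau>"] \<open>p > 0\<close> \<open>\<alpha> > 0\<close> by (simp add: W_def field_simps)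
        ultimately show ?thesis
          using diss[OF \<open>\<tau> \<ge> 0\<close>, of "x \<tau>"] by (simp add: g_def u_def)
      qed
      then show "(if \<tau> \<in> N then u \<tau> else g \<tau>) \<le> u \<tau>" by simp
    qed
    finally show "W t - W s \<le> integral {s..t} (\<lambda>\<tau>. b - \<alpha> / p * W \<tau>)"
      by (simp add: u_def)
  qed
  also have "(1 - exp (- (\<alpha> / p) * t)) * (b / (\<alpha> / p)) \<le> b / (\<alpha> / p)"
    using \<open>\<alpha> > 0\<close> \<open>p > 0\<close> \<open>b \<ge> 0\<close> \<open>t \<ge> 0\<close> by (intro mult_left_le_one_le) simp_all
  finally show ?thesis
    by (simp add: W_def b_def mult_ac)
qed

section \<open>Comparison functions and the stability estimate\<close>

lemma class_KL_exponential:
  assumes "k > 0" "\<rho> > 0"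
  shows "class_KL (\<lambda>r t. k * exp (- \<rho> * t) * r)"
  unfolding class_KL_def class_K_def
proof (intro conjI allI impI)
  show "continuous_on ({0..} \<times> {0..}) (\<lambda>(r, t). k * exp (- \<rho> * t) * r)"
    by (auto simp: case_prod_unfold intro!: continuous_intros)
next
  fix r :: real assume "r \<ge> 0"
  show "antimono_on {0..} (\<lambda>t. k * exp (- \<rho> * t) * r)"
    using assms \<open>r \<ge> 0\<close> by (auto simp: monotone_on_def intro!: mult_left_mono mult_right_mono)
  have "filterlim (\<lambda>t. - \<rho> * t) at_bot at_top"
    using filterlim_tendsto_neg_mult_at_bot[OF tendsto_const[of "- \<rho>"] _ filterlim_ident] assms
    by simp
  then have "((\<lambda>t. exp (- \<rho> * t)) \<longlongrightarrow> 0) at_top"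
    by (rule filterlim_compose[OF exp_at_bot])
  then have "((\<lambda>t. k * exp (- \<rho> * t) * r) \<longlongrightarrow> k * 0 * r) at_top"
    by (intro tendsto_intros)
  then show "((\<lambda>t. k * exp (- \<rho> * t) * r) \<longlongrightarrow> 0) at_top" by simp
qed (use assms in \<open>auto simp: strict_mono_on_def intro!: continuous_intros\<close>)

lemma class_K_inf_linear:
  assumes "k > 0"
  shows "class_K_inf (\<lambda>r. k * r)"
  unfolding class_K_inf_def class_K_def
  using assms filterlim_tendsto_pos_mult_at_top[OF tendsto_const[of k] assms filterlim_ident]
  by (auto simp: strict_mono_on_def intro!: continuous_intros)

text \<open>Square roots turn the estimate of the form into one of the norm. \<open>\<beta>\<close>
  and \<open>\<kappa>\<close> are obtained before \<open>F\<close>, \<open>d\<close> and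
  \<open>x\<close>, and depend on the form and the two rates alone; this makes the final bound
  uniform in the switching signal.\<close>

lemma quadratic_lyapunov_iss:
  fixes P :: "'a::euclidean_space \<Rightarrow> 'a"
  assumes lin: "bounded_linear P" and self_adj: "\<And>u v. P u \<bullet> v = u \<bullet> P v"
    and lower: "\<And>v. q * (norm v)\<^sup>2 \<le> v \<bullet> P v" and "q > 0" and "\<alpha> > 0" and "c > 0"
  obtains \<beta> \<kappa> where "class_KL \<beta>" and "class_K_inf \<kappa>"
    and "\<And>F (d :: real \<Rightarrow> 'b::euclidean_space) x t.
      (\<And>t v. t \<ge> 0 \<Longrightarrow> 2 * (P v \<bullet> F t v) \<le> c * (norm (d t))\<^sup>2 - \<alpha> * (norm v)\<^sup>2) \<Longrightarrow>
      d \<in> L_inf \<Longrightarrow> caratheodory_solution F x \<Longrightarrow> t \<ge> 0 \<Longrightarrow>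
      norm (x t) \<le> \<beta> (norm (x 0)) t + \<kappa> (L_inf_norm d)"
proof -
  obtain p where "p > 0" and p: "\<And>v. norm (P v) \<le> norm v * p"
    using bounded_linear.pos_bounded[OF lin] by blast
  have upper: "v \<bullet> P v \<le> p * (norm v)\<^sup>2" for v
  proof -
    have "v \<bullet> P v \<le> norm v * norm (P v)"
      by (rule norm_cauchy_schwarz)
    also have "\<dots> \<le> norm v * (norm v * p)"
      by (intro mult_left_mono p) simp
    finally show ?thesis by (simp add: power2_eq_square mult_ac)
  qed
  \<comment> \<open>\<open>k\<close> and \<open>l\<close> are the square roots of the two
    coefficients after division by \<open>q\<close>; the root also halves the exponential
    rate.\<close>
  define k where "k = sqrt (p / q)"
  define l where "l = sqrt (c * p / (\<alpha> * q))"
  have "k > 0" "l > 0"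
    using \<open>p > 0\<close> \<open>q > 0\<close> \<open>\<alpha> > 0\<close> \<open>c > 0\<close> by (simp_all add: k_def l_def)
  show thesis
  proof
    show "class_KL (\<lambda>r t. k * exp (- (\<alpha> / (2 * p)) * t) * r)"
      using \<open>k > 0\<close> \<open>\<alpha> > 0\<close> \<open>p > 0\<close> by (intro class_KL_exponential) auto
    show "class_K_inf (\<lambda>r. l * r)"
      using \<open>l > 0\<close> by (rule class_K_inf_linear)
    fix F and d :: "real \<Rightarrow> 'b" and x and t :: real
    assume diss: "\<And>t v. t \<ge> 0 \<Longrightarrow> 2 * (P v \<bullet> F t v) \<le> c * (norm (d t))\<^sup>2 - \<alpha> * (norm v)\<^sup>2"
      and d: "d \<in> L_inf" and sol: "caratheodory_solution F x" and "t \<ge> 0"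
    define y where "y = k * exp (- (\<alpha> / (2 * p)) * t) * norm (x 0)"
    define z where "z = l * L_inf_norm d"
    have "y \<ge> 0" "z \<ge> 0"
      using \<open>k > 0\<close> \<open>l > 0\<close> L_inf_norm_nonneg[OF d] by (simp_all add: y_def z_def)
    have "(exp (- (\<alpha> / (2 * p)) * t))\<^sup>2 = exp (- (\<alpha> / p) * t)"
      by (simp add: exp_double[symmetric])
    then have y2: "q * y\<^sup>2 = exp (- (\<alpha> / p) * t) * (p * (norm (x 0))\<^sup>2)"
      using \<open>p > 0\<close> \<open>q > 0\<close> by (simp add: y_def k_def power_mult_distrib)
    have z2: "q * z\<^sup>2 = c * p / \<alpha> * (L_inf_norm d)\<^sup>2"
      using \<open>p > 0\<close> \<open>q > 0\<close> \<open>\<alpha> > 0\<close> \<open>c > 0\<close> by (simp add: z_def l_def power_mult_distrib)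
    have "q * (norm (x t))\<^sup>2 \<le> x t \<bullet> P (x t)"
      by (rule lower)
    also have "\<dots> \<le> exp (- (\<alpha> / p) * t) * (x 0 \<bullet> P (x 0)) + c * p / \<alpha> * (L_inf_norm d)\<^sup>2"
      using \<open>c > 0\<close>
      by (intro quadratic_lyapunov_estimate[OF lin self_adj upper \<open>p > 0\<close> \<open>\<alpha> > 0\<close> _ diss d sol \<open>t \<ge> 0\<close>]) simp_all
    also have "\<dots> \<le> q * y\<^sup>2 + q * z\<^sup>2"
      unfolding y2 z2 using mult_left_mono[OF upper[of "x 0"], of "exp (- (\<alpha> / p) * t)"] by simp
    \<comment> \<open>The mixed term \<open>2 * y * z\<close> is nonnegative.\<close>
    also have "\<dots> \<le> q * (y + z)\<^sup>2"
      using \<open>q > 0\<close> \<open>y \<ge> 0\<close> \<open>z \<ge> 0\<close> by (simp add: power2_sum distrib_left)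
    finally have "(norm (x t))\<^sup>2 \<le> (y + z)\<^sup>2"
      using \<open>q > 0\<close> by simp
    then have "norm (x t) \<le> y + z"
      using \<open>y \<ge> 0\<close> \<open>z \<ge> 0\<close> power2_le_imp_le by simp
    then show "norm (x t) \<le> k * exp (- (\<alpha> / (2 * p)) * t) * norm (x 0) + l * L_inf_norm d"
      by (simp add: y_def z_def)
  qed
qed


section \<open>Block matrices and the gain design\<close>

lemma inner_matrix_vector_transpose:
  fixes B :: "real ^ 'c::finite ^ 'r::finite"
  shows "x \<bullet> (B *v y) = (transpose B *v x) \<bullet> y"
  by (simp add: transpose_matrix_vector dot_lmul_matrix)

lemma norm_mat_vec_le: "norm (B *v x) \<le> mat_norm B * norm x"
  unfolding mat_norm_def by (rule onorm[OF matrix_vector_mul_bounded_linear])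

lemma mat_norm_nonneg: "mat_norm B \<ge> 0"
  unfolding mat_norm_def by (rule onorm_pos_le[OF matrix_vector_mul_bounded_linear])

lemma scaleR_matrix_vector: "(c *\<^sub>R B) *v x = c *\<^sub>R (B *v (x :: real ^ 'n::finite))"
  by (simp add: vec_eq_iff matrix_vector_mult_def sum_distrib_left mult.assoc)

lemma uminus_matrix_vector: "(- B) *v x = - (B *v (x :: real ^ 'n::finite))"
  by (simp add: vec_eq_iff matrix_vector_mult_def sum_negf)

lemma pos_def_invertible:
  fixes B :: "real ^ 'n::finite ^ 'n"
  assumes "pos_def B"
  shows "invertible B"
proof -
  have "x = 0" if "B *v x = 0" for x
    using assms that unfolding pos_def_def by (metis inner_zero_right less_irrefl)
  then show ?thesis
    using matrix_left_invertible_ker[of B] invertible_left_inverse by blast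
qed

text \<open>The form attains a positive minimum on the compact unit sphere, and homogeneity of
  degree 2 carries it to all vectors. The argument avoids eigenvalues, as \<open>pos_def\<close>
  does not include symmetry.\<close>

lemma pos_def_coercive:
  fixes B :: "real ^ 'n::finite ^ 'n"
  assumes "pos_def B"
  obtains q where "q > 0" and "\<And>v. q * (norm v)\<^sup>2 \<le> v \<bullet> (B *v v)"
proof -
  have "\<exists>e\<in>sphere 0 1. \<forall>v\<in>sphere 0 1. e \<bullet> (B *v e) \<le> v \<bullet> (B *v v)"
    by (intro continuous_attains_inf continuous_intros
        bounded_linear.continuous_on[OF matrix_vector_mul_bounded_linear]) auto
  then obtain e :: "real ^ 'n" where e: "e \<in> sphere 0 1"
    and min: "\<And>v. v \<in> sphere 0 1 \<Longrightarrow> e \<bullet> (B *v e) \<le> v \<bullet> (B *v v)"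
    by blast
  show thesis
  proof
    have "e \<noteq> 0"
      using e by auto
    then show "e \<bullet> (B *v e) > 0"
      using assms by (simp add: pos_def_def)
    fix v :: "real ^ 'n"
    show "e \<bullet> (B *v e) * (norm v)\<^sup>2 \<le> v \<bullet> (B *v v)"
    proof (cases "v = 0")
      case False
      have "e \<bullet> (B *v e) * (norm v)\<^sup>2 \<le> (v /\<^sub>R norm v) \<bullet> (B *v (v /\<^sub>R norm v)) * (norm v)\<^sup>2"
        using False by (intro mult_right_mono min) auto
      also have "\<dots> = v \<bullet> (B *v v)"
        using False by (simp add: matrix_vector_mult_scaleR power2_eq_square field_simps)
      finally show ?thesis .
    qed simp
  qed
qed

section \<open>Blockwise computation\<close>

lemma inner_block: "x \<bullet> y = (\<Sum>i\<in>UNIV. block x i \<bullet> block y i)"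
  by (simp add: inner_vec_def block_def UNIV_Times_UNIV[symmetric] sum.cartesian_product'
      del: UNIV_Times_UNIV)

lemma norm_block: "(norm x)\<^sup>2 = (\<Sum>i\<in>UNIV. (norm (block x i))\<^sup>2)"
  by (simp add: power2_norm_eq_inner inner_block)

lemma block_add: "block (x + y) i = block x i + block y i"
  by (simp add: vec_eq_iff block_def)

lemma block_col: "block (col v) i = v i"
  by (simp add: vec_eq_iff block_def col_def)

lemma block_eq_0_iff: "x = 0 \<longleftrightarrow> (\<forall>i. block x i = 0)"
  by (auto simp: vec_eq_iff block_def)

lemma transpose_bdiag: "transpose (bdiag B) = bdiag (\<lambda>i. transpose (B i))"
  by (auto simp: vec_eq_iff transpose_def bdiag_def)

lemma pos_def_bdiag:
  assumes "\<And>i. pos_def (B i)"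
  shows "pos_def (bdiag B)"
  unfolding pos_def_def
proof (intro allI impI)
  fix z :: "real ^ ('a \<times> 'b)" assume "z \<noteq> 0"
  then obtain j where j: "block z j \<noteq> 0"
    using block_eq_0_iff by blast
  have nonneg: "block z i \<bullet> (B i *v block z i) \<ge> 0" for i
    using assms[of i] unfolding pos_def_def by (cases "block z i = 0") (auto intro: less_imp_le)
  have "block z j \<bullet> (B j *v block z j) > 0"
    using assms[of j] j unfolding pos_def_def by blast
  then show "0 < z \<bullet> (bdiag B *v z)"
    unfolding inner_block[of z] block_bdiag_mult
    using nonneg by (intro sum_pos2[of _ j]) auto
qed

text \<open>Regroup the coordinates the other way: the slice that collects the \<open>k\<close>-th
  coordinate of every agent is mapped by \<open>B\<close> alone, and the squared norms of the slices
  add up to that of the whole vector.\<close>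

lemma norm_kron_mat_1_le:
  fixes B :: "real ^ 'n::finite ^ 'n"
  shows "norm ((B \<otimes>\<^sub>K (mat 1 :: real ^ 'x::finite ^ 'x)) *v x) \<le> mat_norm B * norm x"
proof -
  define slice where "slice y k = (\<chi> i. block y i $ k)" for y :: "real ^ ('n \<times> 'x)" and k
  have norm_slice: "(norm y)\<^sup>2 = (\<Sum>k\<in>UNIV. (norm (slice y k))\<^sup>2)" for y
  proof -
    have "(norm y)\<^sup>2 = (\<Sum>i\<in>UNIV. \<Sum>k\<in>UNIV. (block y i $ k)\<^sup>2)"
      unfolding norm_block power2_norm_eq_inner inner_vec_def by (simp add: power2_eq_square)
    also have "\<dots> = (\<Sum>k\<in>UNIV. \<Sum>i\<in>UNIV. (block y i $ k)\<^sup>2)"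
      by (rule sum.swap)
    finally show ?thesis
      unfolding slice_def power2_norm_eq_inner inner_vec_def by (simp add: power2_eq_square)
  qed
  have slice_kron: "slice ((B \<otimes>\<^sub>K mat 1) *v x) k = B *v slice x k" for k
    unfolding slice_def block_kron_mat_1_mult by (simp add: vec_eq_iff matrix_vector_mult_def)
  have "(norm ((B \<otimes>\<^sub>K (mat 1 :: real ^ 'x ^ 'x)) *v x))\<^sup>2 = (\<Sum>k\<in>UNIV. (norm (B *v slice x k))\<^sup>2)"
    unfolding norm_slice slice_kron ..
  also have "\<dots> \<le> (\<Sum>k\<in>UNIV. (mat_norm B * norm (slice x k))\<^sup>2)"
    by (intro sum_mono power_mono norm_mat_vec_le) simp
  also have "\<dots> = (mat_norm B * norm x)\<^sup>2"
    by (simp add: norm_slice[of x] power_mult_distrib sum_distrib_left)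
  finally show ?thesis
    by (rule power2_le_imp_le) (simp add: mat_norm_nonneg)
qed

section \<open>The optimal gain and the quadratic forms of the design\<close>

lemma lqr_gain_mult:
  assumes "pos_def R" "K = lqr_gain \<mu> B R P"
  shows "R *v (K *v X) = - (\<mu> *\<^sub>R (transpose B *v (P *v X)))"
proof -
  \<comment> \<open>\<open>matrix_inv\<close> is defined by choice; it is a genuine inverse because
    a positive definite matrix is invertible.\<close>
  have "R ** matrix_inv R = mat 1"
    using someI_ex[OF pos_def_invertible[OF assms(1), unfolded invertible_def]]
    by (simp add: matrix_inv_def)
  then have "R *v (matrix_inv R *v w) = w" for w
    by (simp add: matrix_vector_mul_assoc)
  then show ?thesis
    by (simp add: assms(2) lqr_gain_def uminus_matrix_vector scaleR_matrix_vector
        matrix_vector_mult_scaleR matrix_vector_mul_assoc[symmetric]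
        linear_neg[OF matrix_vector_mul_linear])
qed

text \<open>The Riccati equation is evaluated as a quadratic form at \<open>X\<close>. Its two drift
  terms coincide since \<open>P\<close> is symmetric, and its last term is the input cost: with
  \<open>K *v X = - (\<mu> *\<^sub>R w)\<close> and
  \<open>R *v (K *v X) = - (\<mu> *\<^sub>R b)\<close> the signs cancel.\<close>

lemma riccati_quadratic_form:
  fixes A Q P :: "real ^ 'x::finite ^ 'x" and R :: "real ^ 'u::finite ^ 'u"
  assumes ric: "riccati_solution \<mu> A B (Q + c *\<^sub>R mat 1) R P"
    and R: "pos_def R" and K: "K = lqr_gain \<mu> B R P"
  shows "2 * ((P *v X) \<bullet> (A *v X))
    = (K *v X) \<bullet> (R *v (K *v X)) - X \<bullet> (Q *v X) - c * (norm X)\<^sup>2"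
proof -
  have sym: "transpose P = P"
    using ric by (simp add: riccati_solution_def sym_mat_def)
  define b where "b = transpose B *v (P *v X)"
  define w where "w = matrix_inv R *v b"
  have Kw: "K *v X = - (\<mu> *\<^sub>R w)"
    by (simp add: K lqr_gain_def w_def b_def uminus_matrix_vector scaleR_matrix_vector
        matrix_vector_mul_assoc[symmetric])
  have "(transpose A ** P + P ** A + (Q + c *\<^sub>R mat 1)
       - \<mu>\<^sup>2 *\<^sub>R (P ** B ** matrix_inv R ** transpose B ** P)) *v X = 0"
    using ric by (simp add: riccati_solution_def)
  then have "transpose A *v (P *v X) + P *v (A *v X) + (Q *v X + c *\<^sub>R X)
      - \<mu>\<^sup>2 *\<^sub>R (P *v (B *v w)) = 0"
    by (simp add: matrix_vector_mult_add_rdistrib matrix_vector_mult_diff_rdistrib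
        scaleR_matrix_vector matrix_vector_mul_assoc[symmetric] w_def b_def)
  then have "X \<bullet> (transpose A *v (P *v X)) + X \<bullet> (P *v (A *v X)) + X \<bullet> (Q *v X) + c * (X \<bullet> X)
      - \<mu>\<^sup>2 * (X \<bullet> (P *v (B *v w))) = 0"
    by (metis (no_types, lifting) inner_add_right inner_diff_right inner_scaleR_right inner_zero_right add.assoc)
  moreover have "X \<bullet> (transpose A *v (P *v X)) = (P *v X) \<bullet> (A *v X)"
    using inner_matrix_vector_transpose[of "P *v X" A X] by (simp add: inner_commute)
  moreover have "X \<bullet> (P *v (A *v X)) = (P *v X) \<bullet> (A *v X)"
    by (simp add: inner_matrix_vector_transpose[of X P] sym)
  moreover have "X \<bullet> (P *v (B *v w)) = b \<bullet> w"
    by (simp add: inner_matrix_vector_transpose[of _ P] inner_matrix_vector_transpose[of _ B] sym b_def)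
  moreover have "(K *v X) \<bullet> (R *v (K *v X)) = \<mu>\<^sup>2 * (b \<bullet> w)"
  proof -
    have "R *v (K *v X) = - (\<mu> *\<^sub>R b)"
      unfolding b_def by (rule lqr_gain_mult[OF R K])
    then show ?thesis
      by (simp only:) (simp add: Kw power2_eq_square inner_commute)
  qed
  ultimately show ?thesis
    by (simp add: power2_norm_eq_inner)
qed

text \<open>With \<open>w\<close> the stacked feedback, \<open>E *v w\<close> has the blocks of
  \<open>U v\<close> divided by \<open>\<mu>\<close>, minus those of \<open>w\<close>. So
  \<open>R + 2 R E\<close> yields the coupled term with factor \<open>2 / \<mu>\<close> and turns
  the input cost into its negative. The agents interact in this sum through \<open>U\<close>
  alone.\<close>

lemma Q_v_quadratic_form:
  fixes Bf :: "'n::finite \<Rightarrow> real ^ 'g::finite ^ 'x::finite" and R :: "'n \<Rightarrow> real ^ 'u::finite ^ 'u"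
    and K :: "'n \<Rightarrow> real ^ 'x ^ 'u" and H :: "real ^ 'n ^ 'n"
  assumes sym: "\<And>i. sym_mat (P i)"
  defines "U \<equiv> \<lambda>v. block ((H \<otimes>\<^sub>K (mat 1 :: real ^ 'u ^ 'u)) *v (bdiag K *v v))"
  shows "v \<bullet> (Q_v \<mu> a\<^sub>f Bf Q R P K H *v v) = (\<Sum>i\<in>UNIV.
      block v i \<bullet> (Q i *v block v i)
      + (2 / \<mu>) * ((K i *v block v i) \<bullet> (R i *v U v i))
      - (K i *v block v i) \<bullet> (R i *v (K i *v block v i))
      - (1 / a\<^sub>f) * (norm (transpose (Bf i) *v (P i *v block v i)))\<^sup>2)"
proof -
  define w where "w = bdiag K *v v"
  define E where "E = ((1 / \<mu>) *\<^sub>R H - mat 1) \<otimes>\<^sub>K (mat 1 :: real ^ 'u ^ 'u)"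
  have E: "block (E *v w) i = (1 / \<mu>) *\<^sub>R U v i - block w i" for i
  proof -
    have "block (E *v w) i
        = (\<Sum>j\<in>UNIV. (1 / \<mu>) *\<^sub>R (H $ i $ j *\<^sub>R block w j) - (if i = j then block w j else 0))"
      unfolding E_def block_kron_mat_1_mult
      by (intro sum.cong) (auto simp: mat_def algebra_simps)
    then show ?thesis
      by (simp add: U_def w_def[symmetric] block_kron_mat_1_mult sum_subtractf scaleR_sum_right)
  qed
  have "v \<bullet> (Q_v \<mu> a\<^sub>f Bf Q R P K H *v v)
      = v \<bullet> (bdiag Q *v v) + v \<bullet> (transpose (bdiag K) *v (bdiag R *v w + 2 *\<^sub>R (bdiag R *v (E *v w))))
      - (1 / a\<^sub>f) * (v \<bullet> (bdiag P *v (bdiag Bf *v (transpose (bdiag Bf) *v (bdiag P *v v)))))"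
    by (simp add: Q_v_def Let_def E_def w_def matrix_vector_mult_add_rdistrib
        matrix_vector_mult_diff_rdistrib scaleR_matrix_vector matrix_vector_mul_assoc[symmetric]
        inner_add_right inner_diff_right)
  also have "v \<bullet> (transpose (bdiag K) *v (bdiag R *v w + 2 *\<^sub>R (bdiag R *v (E *v w))))
      = w \<bullet> (bdiag R *v w) + 2 * (w \<bullet> (bdiag R *v (E *v w)))"
    unfolding inner_matrix_vector_transpose[of v "transpose (bdiag K)"] transpose_transpose
      w_def[symmetric] by (simp add: inner_add_right)
  also have "v \<bullet> (bdiag P *v (bdiag Bf *v (transpose (bdiag Bf) *v (bdiag P *v v))))
      = (norm (transpose (bdiag Bf) *v (bdiag P *v v)))\<^sup>2"
    using sym
    by (simp add: inner_matrix_vector_transpose[of v] inner_matrix_vector_transpose[of _ "bdiag Bf"]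
        transpose_bdiag sym_mat_def power2_norm_eq_inner)
  finally show ?thesis
    unfolding inner_block norm_block transpose_bdiag block_bdiag_mult E
    unfolding w_def block_bdiag_mult
    by (simp add: sum.distrib sum_subtractf sum_distrib_left[symmetric] sum_divide_distrib[symmetric]
        matrix_vector_mult_diff_distrib
        matrix_vector_mult_scaleR inner_diff_right algebra_simps)
qed

section \<open>Dissipation along the closed loop\<close>

lemma young_inner:
  fixes x y :: "'a::real_inner"
  assumes "c > 0"
  shows "2 * (x \<bullet> y) \<le> (1 / c) * (norm x)\<^sup>2 + c * (norm y)\<^sup>2"
proof -
  have "0 \<le> (1 / c) * (norm (x - c *\<^sub>R y))\<^sup>2"
    using assms by simp
  also have "\<dots> = (1 / c) * (norm x)\<^sup>2 + c * (norm y)\<^sup>2 - 2 * (x \<bullet> y)"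
  proof -
    have "(norm (x - c *\<^sub>R y))\<^sup>2 = (norm x)\<^sup>2 - 2 * c * (x \<bullet> y) + c\<^sup>2 * (norm y)\<^sup>2"
      unfolding power2_norm_eq_inner
      by (simp add: inner_diff_left inner_diff_right inner_commute power2_eq_square)
    then show ?thesis
      using assms by (simp add: field_simps power2_eq_square)
  qed
  finally show ?thesis by simp
qed

lemma agent_output_norm_le:
  fixes Cy :: "'n::finite \<Rightarrow> real ^ 'x::finite ^ 'y::finite"
  assumes Cy: "\<And>i. (mat_norm (Cy i))\<^sup>2 \<le> \<gamma>"
  shows "(norm (agent_output Aa Cy v))\<^sup>2 \<le> \<gamma> * (mat_norm Aa)\<^sup>2 * (norm v)\<^sup>2"
proof -
  define z where "z = (Aa \<otimes>\<^sub>K (mat 1 :: real ^ 'x ^ 'x)) *v v"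
  \<comment> \<open>Any single agent shows this, as \<open>\<gamma>\<close> dominates a
    square.\<close>
  have "\<gamma> \<ge> 0"
    using Cy zero_le_power2 order_trans by blast
  have "(norm (Cy i *v block z i))\<^sup>2 \<le> \<gamma> * (norm (block z i))\<^sup>2" for i
  proof -
    have "(norm (Cy i *v block z i))\<^sup>2 \<le> (mat_norm (Cy i) * norm (block z i))\<^sup>2"
      by (intro power_mono norm_mat_vec_le) simp
    also have "\<dots> \<le> \<gamma> * (norm (block z i))\<^sup>2"
      unfolding power_mult_distrib by (intro mult_right_mono Cy) simp
    finally show ?thesis .
  qed
  then have "(norm (agent_output Aa Cy v))\<^sup>2 \<le> \<gamma> * (norm z)\<^sup>2"
    unfolding norm_block agent_output_def z_def[symmetric] block_bdiag_mult sum_distrib_left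
    by (intro sum_mono)
  also have "\<dots> \<le> \<gamma> * (mat_norm Aa * norm v)\<^sup>2"
    unfolding z_def using \<open>\<gamma> \<ge> 0\<close> by (intro mult_left_mono power_mono norm_kron_mat_1_le) auto
  finally show ?thesis
    by (simp add: power_mult_distrib mult.assoc)
qed

text \<open>Stated at one time and for one matrix \<open>H\<close>, so that it can be used at each
  instant of a switched loop. The perturbation term is kept exact; it is paid for later with half of
  \<open>a\<^sub>d\<close>.\<close>

lemma closed_loop_dissipation:
  fixes A :: "'n::finite \<Rightarrow> real ^ 'x::finite ^ 'x"
    and Bu :: "'n \<Rightarrow> real ^ 'u::finite ^ 'x"
    and Bf :: "'n \<Rightarrow> real ^ 'g::finite ^ 'x"
    and Bd :: "'n \<Rightarrow> real ^ 'd::finite ^ 'x"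
    and Cy :: "'n \<Rightarrow> real ^ 'x ^ 'y::finite"
  assumes Cy: "\<And>i. (mat_norm (Cy i))\<^sup>2 \<le> \<gamma>cy"
    and f: "\<And>i y. f i y t \<bullet> f i y t \<le> \<gamma>f * (y \<bullet> y)" and "\<gamma>f \<ge> 0" and "a\<^sub>f > 0"
    and R: "\<And>i. sym_mat (R i) \<and> pos_def (R i)"
    and P: "\<And>i. riccati_solution \<mu> (A i) (Bu i)
              (Q i + (a\<^sub>f * \<gamma>f * \<gamma>cy * (mat_norm Aa)\<^sup>2 + a\<^sub>d) *\<^sub>R mat 1) (R i) (P i)"
    and K: "\<And>i. K i = lqr_gain \<mu> (Bu i) (R i) (P i)"
  shows "2 * ((bdiag P *v v) \<bullet> closed_loop_rhs A Bu Bf Bd Aa Cy f K H d t v)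
    \<le> 2 * ((bdiag P *v v) \<bullet> (bdiag Bd *v d)) - v \<bullet> (Q_v \<mu> a\<^sub>f Bf Q R P K H *v v) - a\<^sub>d * (norm v)\<^sup>2"
proof -
  define X where "X = block v"
  define U where "U = block ((H \<otimes>\<^sub>K (mat 1 :: real ^ 'u ^ 'u)) *v (bdiag K *v v))"
  define \<Phi> where "\<Phi> i = f i (block (agent_output Aa Cy v) i) t" for i
  define c where "c = a\<^sub>f * \<gamma>f * \<gamma>cy * (mat_norm Aa)\<^sup>2"
  define q where "q i = X i \<bullet> (Q i *v X i) + (2 / \<mu>) * ((K i *v X i) \<bullet> (R i *v U i))
      - (K i *v X i) \<bullet> (R i *v (K i *v X i))
      - (1 / a\<^sub>f) * (norm (transpose (Bf i) *v (P i *v X i)))\<^sup>2" for i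
  have sym: "sym_mat (P i)" for i
    using P[of i] by (simp add: riccati_solution_def)
  \<comment> \<open>The gain satisfies R K = -\<mu> B^T P, which turns the input power into the
    coupled term of \<open>q\<close> with the opposite sign.\<close>
  have input: "2 * ((P i *v X i) \<bullet> (Bu i *v U i)) = - (2 / \<mu>) * ((K i *v X i) \<bullet> (R i *v U i))" for i
  proof (cases "\<mu> = 0")
    case True
    \<comment> \<open>Here \<open>2 / \<mu> = 0\<close>, and both sides vanish because \<open>K = 0\<close>.\<close>
    then have "K j = 0" for j
      by (simp add: K lqr_gain_def)
    then have "U i = 0"
      by (simp add: U_def block_kron_mat_1_mult block_bdiag_mult)
    then show ?thesis by simp
  next
    case False
    have "(K i *v X i) \<bullet> (R i *v U i) = (R i *v (K i *v X i)) \<bullet> U i"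
      using R[of i] by (simp add: inner_matrix_vector_transpose[of _ "R i"] sym_mat_def)
    also have "\<dots> = - \<mu> * ((P i *v X i) \<bullet> (Bu i *v U i))"
      using R[of i] by (simp add: lqr_gain_mult[OF _ K] inner_matrix_vector_transpose[of _ "Bu i"])
    finally show ?thesis
      using False by simp
  qed
  have agent: "2 * ((P i *v X i) \<bullet> (A i *v X i + Bu i *v U i + Bf i *v \<Phi> i))
      \<le> a\<^sub>f * (norm (\<Phi> i))\<^sup>2 - q i - (c + a\<^sub>d) * (norm (X i))\<^sup>2" for i
  proof -
    have "2 * ((P i *v X i) \<bullet> (Bf i *v \<Phi> i))
        \<le> (1 / a\<^sub>f) * (norm (transpose (Bf i) *v (P i *v X i)))\<^sup>2 + a\<^sub>f * (norm (\<Phi> i))\<^sup>2"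
      unfolding inner_matrix_vector_transpose[of _ "Bf i"] by (rule young_inner[OF \<open>a\<^sub>f > 0\<close>])
    moreover have "2 * ((P i *v X i) \<bullet> (A i *v X i))
        = (K i *v X i) \<bullet> (R i *v (K i *v X i)) - X i \<bullet> (Q i *v X i) - (c + a\<^sub>d) * (norm (X i))\<^sup>2"
      using R[of i] by (intro riccati_quadratic_form[OF P[of i, folded c_def] _ K]) simp
    ultimately show ?thesis
      using input[of i] by (simp add: q_def inner_add_right)
  qed
  \<comment> \<open>The interconnection is bounded in total, not per agent: an agent's output
    involves the states of the others.\<close>
  have "(\<Sum>i\<in>UNIV. (norm (\<Phi> i))\<^sup>2) \<le> \<gamma>f * (norm (agent_output Aa Cy v))\<^sup>2"
    unfolding norm_block[of "agent_output Aa Cy v"] sum_distrib_left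
    by (intro sum_mono) (simp add: \<Phi>_def power2_norm_eq_inner f)
  also have "\<dots> \<le> \<gamma>f * (\<gamma>cy * (mat_norm Aa)\<^sup>2 * (norm v)\<^sup>2)"
    using \<open>\<gamma>f \<ge> 0\<close> by (intro mult_left_mono agent_output_norm_le Cy)
  finally have "a\<^sub>f * (\<Sum>i\<in>UNIV. (norm (\<Phi> i))\<^sup>2) \<le> a\<^sub>f * (\<gamma>f * (\<gamma>cy * (mat_norm Aa)\<^sup>2 * (norm v)\<^sup>2))"
    using \<open>a\<^sub>f > 0\<close> by (intro mult_left_mono) auto
  then have interconnection: "a\<^sub>f * (\<Sum>i\<in>UNIV. (norm (\<Phi> i))\<^sup>2) \<le> c * (norm v)\<^sup>2"
    by (simp add: c_def mult.assoc)
  have rhs: "closed_loop_rhs A Bu Bf Bd Aa Cy f K H d t v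
      = (bdiag A *v v + bdiag Bu *v ((H \<otimes>\<^sub>K (mat 1 :: real ^ 'u ^ 'u)) *v (bdiag K *v v))
        + bdiag Bf *v col \<Phi>) + bdiag Bd *v d"
    by (simp add: closed_loop_rhs_def \<Phi>_def[abs_def])
  have "2 * ((bdiag P *v v) \<bullet> closed_loop_rhs A Bu Bf Bd Aa Cy f K H d t v)
      - 2 * ((bdiag P *v v) \<bullet> (bdiag Bd *v d))
      = (\<Sum>i\<in>UNIV. 2 * ((P i *v X i) \<bullet> (A i *v X i + Bu i *v U i + Bf i *v \<Phi> i)))"
    unfolding rhs inner_add_right[of _ _ "bdiag Bd *v d"] inner_block block_add block_bdiag_mult block_col
    by (simp add: X_def U_def sum_distrib_left sum_subtractf[symmetric] inner_add_right algebra_simps)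
  also have "\<dots> \<le> (\<Sum>i\<in>UNIV. a\<^sub>f * (norm (\<Phi> i))\<^sup>2 - q i - (c + a\<^sub>d) * (norm (X i))\<^sup>2)"
    by (intro sum_mono agent)
  also have "\<dots> = a\<^sub>f * (\<Sum>i\<in>UNIV. (norm (\<Phi> i))\<^sup>2) - sum q UNIV - (c + a\<^sub>d) * (norm v)\<^sup>2"
    by (simp add: sum_subtractf sum_distrib_left norm_block[of v] X_def)
  \<comment> \<open>The weight \<open>c\<close> reserved in the Riccati equation cancels the
    interconnection, and the \<open>q i\<close> sum to the form of \<open>Q_v\<close>.\<close>
  also have "\<dots> \<le> - (v \<bullet> (Q_v \<mu> a\<^sub>f Bf Q R P K H *v v)) - a\<^sub>d * (norm v)\<^sup>2"
    using interconnection Q_v_quadratic_form[OF sym, where v = v and \<mu> = \<mu> and a\<^sub>f = a\<^sub>f and Bf = Bf and Q = Q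
        and R = R and K = K and H = H]
    by (simp add: q_def X_def U_def algebra_simps)
  finally show ?thesis by simp
qed


section \<open>Robust stability of the switched closed loop\<close>

theorem theorem1:
  fixes A :: "'n::finite \<Rightarrow> real ^ 'x::finite ^ 'x"
    and Bu :: "'n \<Rightarrow> real ^ 'u::finite ^ 'x"
    and Bf :: "'n \<Rightarrow> real ^ 'g::finite ^ 'x"
    and Bd :: "'n \<Rightarrow> real ^ 'd::finite ^ 'x"
    and Aa :: "real ^ 'n ^ 'n"
    and Cy :: "'n \<Rightarrow> real ^ 'x ^ 'y::finite"
    and f :: "'n \<Rightarrow> real ^ 'y \<Rightarrow> real \<Rightarrow> real ^ 'g"
    and \<gamma>cyi \<gamma>fi :: "'n \<Rightarrow> real" and \<gamma>cy \<gamma>f :: real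
    and M :: nat
    and a :: "nat \<Rightarrow> 'n \<Rightarrow> 'n \<Rightarrow> real" and s :: "nat \<Rightarrow> 'n \<Rightarrow> real"
    and T :: int and \<theta> :: "'n \<Rightarrow> int" and r :: "'n \<Rightarrow> 'n \<Rightarrow> int"
    and h :: "nat \<Rightarrow> 'n \<Rightarrow> 'n \<Rightarrow> int"
    and Q P :: "'n \<Rightarrow> real ^ 'x ^ 'x" and R :: "'n \<Rightarrow> real ^ 'u ^ 'u"
    and K :: "'n \<Rightarrow> real ^ 'x ^ 'u"
    and a\<^sub>f a\<^sub>d \<mu>min :: real
  assumes stab: "\<And>i. stabilizable (A i) (Bu i)"
    and Cy_bound: "\<And>i. (mat_norm (Cy i))\<^sup>2 \<le> \<gamma>cyi i"
    and \<gamma>cy: "\<gamma>cy = (MAX i. \<gamma>cyi i)" "\<gamma>cy > 0"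
    and f_pc: "\<And>i y. piecewise_cont (f i y)"
    and f_lip: "\<And>i. \<exists>L. \<forall>t\<ge>0. L-lipschitz_on UNIV (\<lambda>y. f i y t)"
    and f_bound: "\<And>i y t. t \<ge> 0 \<Longrightarrow> f i y t \<bullet> f i y t \<le> \<gamma>fi i * (y \<bullet> y)"
    and \<gamma>f: "\<gamma>f = (MAX i. \<gamma>fi i)" "\<gamma>f > 0"
    and M: "M \<ge> 1"
    and sublayers: "\<And>\<sigma>. \<sigma> \<in> {1..M} \<Longrightarrow> control_sublayer (a \<sigma>) (s \<sigma>)"
    and generated: "generated_structures M T \<theta> r h"
    and structures: "\<And>\<sigma>. \<sigma> \<in> {1..M} \<Longrightarrow> has_structure (a \<sigma>) (s \<sigma>) (symmetrize (h \<sigma>))"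
    and \<mu>min: "\<mu>min = (MIN \<sigma>\<in>{1..M}. smallest_eigval (mod_laplacian (a \<sigma>) (s \<sigma>)))"
    and Q: "\<And>i. sym_mat (Q i) \<and> pos_def (Q i)"
    and R: "\<And>i. sym_mat (R i) \<and> pos_def (R i)"
    and scalars: "a\<^sub>f > 0" "a\<^sub>d > 0"
    and P: "\<And>i. riccati_solution \<mu>min (A i) (Bu i)
              (Q i + (a\<^sub>f * \<gamma>f * \<gamma>cy * (mat_norm Aa)\<^sup>2 + a\<^sub>d) *\<^sub>R mat 1) (R i) (P i)"
    and K: "\<And>i. K i = lqr_gain \<mu>min (Bu i) (R i) (P i)"
    and valid: "\<And>\<sigma>. \<sigma> \<in> {1..M} \<Longrightarrow>
              pos_def (Q_v \<mu>min a\<^sub>f Bf Q R P K (mod_laplacian (a \<sigma>) (s \<sigma>)))"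
  shows "\<exists>\<beta> \<kappa>. class_KL \<beta> \<and> class_K_inf \<kappa> \<and>
    (\<forall>\<sigma> d x. admissible_switching M \<sigma> \<longrightarrow> d \<in> L_inf \<longrightarrow>
       caratheodory_solution
         (\<lambda>t. closed_loop_rhs A Bu Bf Bd Aa Cy f K
                (mod_laplacian (a (\<sigma> t)) (s (\<sigma> t))) (d t) t) x \<longrightarrow>
       (\<forall>t\<ge>0. norm (x t) \<le> \<beta> (norm (x 0)) t + \<kappa> (L_inf_norm d)))"
proof -
  let ?P = "bdiag P"
  let ?H = "\<lambda>\<sigma>. mod_laplacian (a \<sigma>) (s \<sigma>)"
  have Cy: "(mat_norm (Cy i))\<^sup>2 \<le> \<gamma>cy" for i
    unfolding \<gamma>cy(1) by (rule order_trans[OF Cy_bound Max_ge]) auto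
  have f: "f i y t \<bullet> f i y t \<le> \<gamma>f * (y \<bullet> y)" if "t \<ge> 0" for i y t
  proof -
    have "\<gamma>fi i \<le> \<gamma>f"
      unfolding \<gamma>f(1) by (rule Max_ge) auto
    then show ?thesis
      using f_bound[OF that, of i y] mult_right_mono[of "\<gamma>fi i" \<gamma>f "y \<bullet> y"] by simp
  qed
  have P_sym: "transpose ?P = ?P"
    using P by (simp add: transpose_bdiag riccati_solution_def sym_mat_def)
  have "pos_def ?P"
    using P by (intro pos_def_bdiag) (simp add: riccati_solution_def)
  then obtain q where "q > 0" and q: "\<And>v. q * (norm v)\<^sup>2 \<le> v \<bullet> (?P *v v)"
    by (rule pos_def_coercive) blast
  \<comment> \<open>Adding 1 keeps \<open>C\<close> positive when the norm vanishes, so that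
    \<open>c\<close> is a legitimate weight in Young's inequality.\<close>
  define C where "C = mat_norm (transpose (bdiag Bd) ** ?P) + 1"
  have "C > 0"
    using mat_norm_nonneg[of "transpose (bdiag Bd) ** ?P"] by (simp add: C_def)
  \<comment> \<open>Chosen so that \<open>(1 / c) * (C * norm v)\<^sup>2\<close> is exactly
    \<open>a\<^sub>d / 2 * (norm v)\<^sup>2\<close>: half of the margin absorbs the perturbation and
    half remains as decay.\<close>
  define c where "c = 2 * C\<^sup>2 / a\<^sub>d"
  have "c > 0" "a\<^sub>d / 2 > 0"
    using \<open>C > 0\<close> scalars by (simp_all add: c_def)
  have diss: "2 * ((?P *v v) \<bullet> closed_loop_rhs A Bu Bf Bd Aa Cy f K (?H \<sigma>) d t v)
      \<le> c * (norm d)\<^sup>2 - a\<^sub>d / 2 * (norm v)\<^sup>2" if "\<sigma> \<in> {1..M}" "t \<ge> 0" for \<sigma> d t v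
  proof -
    have "v \<bullet> (Q_v \<mu>min a\<^sub>f Bf Q R P K (?H \<sigma>) *v v) \<ge> 0"
      using valid[OF that(1)] unfolding pos_def_def by (cases "v = 0") (auto intro: less_imp_le)
    moreover have "2 * ((?P *v v) \<bullet> (bdiag Bd *v d)) \<le> a\<^sub>d / 2 * (norm v)\<^sup>2 + c * (norm d)\<^sup>2"
    proof -
      define w where "w = (transpose (bdiag Bd) ** ?P) *v v"
      have "norm w \<le> mat_norm (transpose (bdiag Bd) ** ?P) * norm v"
        unfolding w_def by (rule norm_mat_vec_le)
      also have "\<dots> \<le> C * norm v"
        by (intro mult_right_mono) (simp_all add: C_def)
      finally have "(norm w)\<^sup>2 \<le> (C * norm v)\<^sup>2"
        by (rule power_mono) simp
      then have "(1 / c) * (norm w)\<^sup>2 \<le> (1 / c) * (C * norm v)\<^sup>2"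
        using \<open>c > 0\<close> by (intro mult_left_mono) auto
      also have "\<dots> = a\<^sub>d / 2 * (norm v)\<^sup>2"
        using \<open>C > 0\<close> by (simp add: c_def power_mult_distrib)
      finally have "(1 / c) * (norm w)\<^sup>2 \<le> a\<^sub>d / 2 * (norm v)\<^sup>2" .
      moreover have "(?P *v v) \<bullet> (bdiag Bd *v d) = w \<bullet> d"
        unfolding inner_matrix_vector_transpose[of _ "bdiag Bd"] w_def matrix_vector_mul_assoc ..
      ultimately show ?thesis
        using young_inner[OF \<open>c > 0\<close>, of w d] by linarith
    qed
    ultimately show ?thesis
      using closed_loop_dissipation[where Cy = Cy and f = f and R = R and P = P and K = K and Q = Q
          and A = A and Bu = Bu and v = v and Bd = Bd and d = d and H = "?H \<sigma>" and Bf = Bf,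
          OF Cy f[OF that(2)] less_imp_le[OF \<gamma>f(2)] scalars(1) R P K]
      by (simp add: field_simps)
  qed
  obtain \<beta> \<kappa> where "class_KL \<beta>" "class_K_inf \<kappa>"
    and iss: "\<And>F (d :: real \<Rightarrow> real ^ ('n \<times> 'd)) x t.
      (\<And>t v. t \<ge> 0 \<Longrightarrow> 2 * ((?P *v v) \<bullet> F t v) \<le> c * (norm (d t))\<^sup>2 - a\<^sub>d / 2 * (norm v)\<^sup>2) \<Longrightarrow>
      d \<in> L_inf \<Longrightarrow> caratheodory_solution F x \<Longrightarrow> t \<ge> 0 \<Longrightarrow>
      norm (x t) \<le> \<beta> (norm (x 0)) t + \<kappa> (L_inf_norm d)"
  proof (rule quadratic_lyapunov_iss[where P = "(*v) ?P" and 'b = "real ^ ('n \<times> 'd)",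
        OF matrix_vector_mul_bounded_linear _ q \<open>q > 0\<close> \<open>a\<^sub>d / 2 > 0\<close> \<open>c > 0\<close>])
    show "(?P *v u) \<bullet> v = u \<bullet> (?P *v v)" for u v
      unfolding inner_matrix_vector_transpose[of u] P_sym ..
  qed blast
  show ?thesis
  proof (intro exI conjI allI impI)
    fix \<sigma> and d :: "real \<Rightarrow> real ^ ('n \<times> 'd)" and x and t :: real
    assume "admissible_switching M \<sigma>" and d: "d \<in> L_inf" and "t \<ge> 0"
      and sol: "caratheodory_solution
        (\<lambda>t. closed_loop_rhs A Bu Bf Bd Aa Cy f K (?H (\<sigma> t)) (d t) t) x"
    \<comment> \<open>At every time the active sublayer is one of the validated ones, so
      \<open>diss\<close>, with constants common to all of them, applies to the switched right-hand
      side.\<close>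
    then have "\<sigma> t \<in> {1..M}" if "t \<ge> 0" for t
      using that by (simp add: admissible_switching_def)
    from iss[OF diss[OF this] d sol \<open>t \<ge> 0\<close>]
    show "norm (x t) \<le> \<beta> (norm (x 0)) t + \<kappa> (L_inf_norm d)" .
  qed fact+
qed

end
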